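(* Let $X$ be a connected, finite, simple $3$-valent graph embedded in the plane, and assume that the number of edges surrounding each face is divisible by $3$. Then: (1) the multiplicity of the eigenvalue $4$ of the Laplacian of $\mathrm{GC}_{2,0}(X)$ is at least $3$; (2) for any $k\in\mathbb{N}$, both $\mathrm{GC}_{k,0}(X)$ and $\mathrm{GC}_{k,k}(X)$ have Laplacian eigenvalue $4$ with multiplicity at least $\lceil k/2\rceil$, and Laplacian eigenvalue $2$ with multiplicity at least $\lfloor k/2\rfloor$.
   Context: The Laplacian of a graph $Y$ acts on $f\in\mathbb{C}^{V(Y)}$ by $(\Delta_Y f)(p)=\deg(p)f(p)-\sum_{q\sim p}f(q)$. A plane embedding gives each vertex the orientation (cyclic order of its three edges) induced by the counterclockwise orientation of the plane, and the Goldberg–Coxeter construction is taken with respect to it. Goldberg–Coxeter construction: let $\omega=e^{\pi i/3}$ and $\mathbb{Z}[\omega]$ the triangular lattice with its unit triangles. For $(k,l)\neq(0,0)$ put $z=k+l\omega$ and let $T$ be the triangle with vertices $0,z,\omega z$. For each $p\in V(X)$ take a copy $\overline{\triangle}(p)$ of the graph whose vertices are the barycenters of the unit lattice triangles meeting the interior of $T$, adjacent when the triangles share an edge; the sides of $T$ are matched with the edges at $p$ so that the cyclic order at $p$ agrees with the counterclockwise order of the sides. For each edge $e=pq$, place $\overline{\triangle}(p)$ on $T$ with $e$ corresponding to the side from $z$ to $\omega z$ and $\overline{\triangle}(q)$ (preserving orientation) on the triangle with vertices $z,(1+\omega)z,\omega z$ with $e$ corresponding to the side from $\omega z$ to $z$,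 and identify all overlapping vertices and edges. The result is the $3$-valent graph $\mathrm{GC}_{k,l}(X)$. *)

theory Defs
  imports "HOL-Analysis.Analysis" "HOL-Library.Function_Algebras"
begin

section \<open>Graphs, Laplacian, eigenvalue multiplicity\<close>

text \<open>A finite simple graph is given by a vertex set V and a symmetric irreflexive
adjacency relation adj (only its restriction to V matters).
Laplacian: (Delta f)(p) = deg(p) f(p) - sum over neighbours q of f(q).\<close>

definition nbrs :: "'v set \<Rightarrow> ('v \<Rightarrow> 'v \<Rightarrow> bool) \<Rightarrow> 'v \<Rightarrow> 'v set" where
  "nbrs V adj p = {q \<in> V. adj p q}"

definition laplacian :: "'v set \<Rightarrow> ('v \<Rightarrow> 'v \<Rightarrow> bool) \<Rightarrow> ('v \<Rightarrow> complex) \<Rightarrow> 'v \<Rightarrow> complex" where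
  "laplacian V adj f p = of_nat (card (nbrs V adj p)) * f p - (\<Sum>q\<in>nbrs V adj p. f q)"

text \<open>The space of functions on V (complex-valued, vanishing outside V) is C^V.
The eigenspace of the Laplacian for lambda, and the multiplicity of lambda
as its dimension over C (the Laplacian is symmetric, so geometric = algebraic).\<close>

definition lap_eigenspace :: "'v set \<Rightarrow> ('v \<Rightarrow> 'v \<Rightarrow> bool) \<Rightarrow> complex \<Rightarrow> ('v \<Rightarrow> complex) set" where
  "lap_eigenspace V adj lam =
     {f. (\<forall>p. p \<notin> V \<longrightarrow> f p = 0) \<and> (\<forall>p\<in>V. laplacian V adj f p = lam * f p)}"

definition lap_mult :: "'v set \<Rightarrow> ('v \<Rightarrow> 'v \<Rightarrow> bool) \<Rightarrow> complex \<Rightarrow> nat" where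
  "lap_mult V adj lam =
     vector_space.dim (\<lambda>(c::complex) (f::'v \<Rightarrow> complex) x. c * f x) (lap_eigenspace V adj lam)"

section \<open>Plane cubic graphs as combinatorial maps (rotation systems)\<close>

text \<open>A graph embedded in the plane is encoded by its rotation system: a finite set D
of darts (half-edges), a fixed-point-free involution alpha (the other half of the
same edge) and a permutation sigma whose cycles are the vertices, sigma giving the
counterclockwise cyclic order of the darts at each vertex. Faces are the orbits of
sigma o alpha. The map is a plane embedding of a connected graph iff the group
generated by sigma, alpha is transitive on D and V - E + F = 2.\<close>

definition orb :: "('a \<Rightarrow> 'a) \<Rightarrow> 'a \<Rightarrow> 'a set" where
  "orb f x = {(f ^^ n) x | n. True}"

definition plane_cubic_simple_map :: "'d set \<Rightarrow> ('d \<Rightarrow> 'd) \<Rightarrow> ('d \<Rightarrow> 'd) \<Rightarrow> bool" where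
  "plane_cubic_simple_map D \<alpha> \<sigma> \<longleftrightarrow>
     finite D \<and> D \<noteq> {} \<and>
     bij_betw \<alpha> D D \<and> bij_betw \<sigma> D D \<and>
     (\<forall>d\<in>D. \<alpha> d \<noteq> d \<and> \<alpha> (\<alpha> d) = d) \<and>
     \<comment> \<open>3-valent: every vertex (sigma-cycle) has exactly three darts\<close>
     (\<forall>d\<in>D. \<sigma> d \<noteq> d \<and> \<sigma> (\<sigma> (\<sigma> d)) = d) \<and>
     \<comment> \<open>no loops\<close>
     (\<forall>d\<in>D. \<alpha> d \<notin> orb \<sigma> d) \<and>
     \<comment> \<open>no multiple edges\<close>
     (\<forall>d\<in>D. \<forall>d'\<in>orb \<sigma> d. d' \<noteq> d \<longrightarrow> orb \<sigma> (\<alpha> d') \<noteq> orb \<sigma> (\<alpha> d)) \<and>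
     \<comment> \<open>connected\<close>
     (\<forall>d\<in>D. \<forall>d'\<in>D. (d, d') \<in> ({(x, \<sigma> x) | x. x \<in> D} \<union> {(x, \<alpha> x) | x. x \<in> D})\<^sup>*) \<and>
     \<comment> \<open>genus 0 (Euler formula V - E + F = 2)\<close>
     int (card (orb \<sigma> ` D)) - int (card (orb \<alpha> ` D)) + int (card (orb (\<sigma> \<circ> \<alpha>) ` D)) = 2"

section \<open>The Goldberg--Coxeter construction\<close>

definition \<omega> :: complex where "\<omega> = cis (pi / 3)"

definition latp :: "int \<Rightarrow> int \<Rightarrow> complex" where
  "latp a b = of_int a + of_int b * \<omega>"

text \<open>Unit triangles of the triangular lattice Z[omega], represented by their vertex sets.\<close>
definition unit_tris :: "complex set set" where
  "unit_tris =
     {{latp a b, latp (a+1) b, latp a (b+1)} | a b. True} \<union>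
     {{latp (a+1) b, latp a (b+1), latp (a+1) (b+1)} | a b. True}"

definition gc_z :: "nat \<Rightarrow> nat \<Rightarrow> complex" where
  "gc_z k l = of_nat k + of_nat l * \<omega>"

text \<open>Unit triangles meeting the interior of T = triangle(0, z, omega z).
These are the vertices (barycenters) of the local piece at each vertex of X.\<close>
definition tri_region :: "complex \<Rightarrow> complex set set" where
  "tri_region z = {t \<in> unit_tris. convex hull t \<inter> interior (convex hull {0, z, \<omega> * z}) \<noteq> {}}"

text \<open>Two unit triangles share an edge.\<close>
definition tri_adj :: "complex set \<Rightarrow> complex set \<Rightarrow> bool" where
  "tri_adj t t' \<longleftrightarrow> t \<in> unit_tris \<and> t' \<in> unit_tris \<and> card (t \<inter> t') = 2"

text \<open>Local copies are indexed by darts: the copy indexed by dart d at vertex p is T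
with the edge of d on the side from z to omega z (sides 0->z, z->omega z, omega z->0
in counterclockwise order matching the cyclic order at p).
gc_rot: change of coordinates from the copy of d to the copy of sigma d
(rotation by -120 degrees about the centroid of T).
gc_refl: change of coordinates from the copy of d to that of alpha d
(the half-turn about the midpoint of the side z -- omega z, which places the
neighbouring copy on triangle(z, (1+omega) z, omega z) with the shared edge on the
side from omega z to z).\<close>
definition gc_rot :: "complex \<Rightarrow> complex \<Rightarrow> complex" where
  "gc_rot z w = \<omega> ^ 4 * w + \<omega> * z"

definition gc_refl :: "complex \<Rightarrow> complex \<Rightarrow> complex" where
  "gc_refl z w = (1 + \<omega>) * z - w"

definition gc_base :: "'d set \<Rightarrow> nat \<Rightarrow> nat \<Rightarrow> ('d \<times> complex set) set" where
  "gc_base D k l = D \<times> tri_region (gc_z k l)"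

definition gc_gen :: "'d set \<Rightarrow> ('d \<Rightarrow> 'd) \<Rightarrow> ('d \<Rightarrow> 'd) \<Rightarrow> nat \<Rightarrow> nat \<Rightarrow>
    (('d \<times> complex set) \<times> ('d \<times> complex set)) set" where
  "gc_gen D \<alpha> \<sigma> k l =
     {((d, t), (\<sigma> d, gc_rot (gc_z k l) ` t)) | d t. d \<in> D \<and> t \<in> tri_region (gc_z k l)} \<union>
     {((d, t), (\<alpha> d, gc_refl (gc_z k l) ` t)) | d t. d \<in> D \<and> t \<in> tri_region (gc_z k l)
          \<and> gc_refl (gc_z k l) ` t \<in> tri_region (gc_z k l)}"

text \<open>Identification of overlapping vertices: the equivalence relation generated.\<close>
definition gc_equiv :: "'d set \<Rightarrow> ('d \<Rightarrow> 'd) \<Rightarrow> ('d \<Rightarrow> 'd) \<Rightarrow> nat \<Rightarrow> nat \<Rightarrow>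
    (('d \<times> complex set) \<times> ('d \<times> complex set)) set" where
  "gc_equiv D \<alpha> \<sigma> k l =
     {(x, y). x \<in> gc_base D k l \<and> y \<in> gc_base D k l \<and>
        (x, y) \<in> (gc_gen D \<alpha> \<sigma> k l \<union> (gc_gen D \<alpha> \<sigma> k l)\<inverse>)\<^sup>*}"

definition gc_verts :: "'d set \<Rightarrow> ('d \<Rightarrow> 'd) \<Rightarrow> ('d \<Rightarrow> 'd) \<Rightarrow> nat \<Rightarrow> nat \<Rightarrow>
    ('d \<times> complex set) set set" where
  "gc_verts D \<alpha> \<sigma> k l = gc_base D k l // gc_equiv D \<alpha> \<sigma> k l"

text \<open>Adjacency: two (distinct) identified vertices are adjacent if some representatives
are barycenters of unit triangles sharing an edge, either inside one copy, or in two
copies placed side by side along an edge of X.\<close>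
definition gc_adj :: "'d set \<Rightarrow> ('d \<Rightarrow> 'd) \<Rightarrow> ('d \<Rightarrow> 'd) \<Rightarrow> nat \<Rightarrow> nat \<Rightarrow>
    ('d \<times> complex set) set \<Rightarrow> ('d \<times> complex set) set \<Rightarrow> bool" where
  "gc_adj D \<alpha> \<sigma> k l P Q \<longleftrightarrow> P \<noteq> Q \<and>
     (\<exists>d t d' t'. (d, t) \<in> P \<and> (d', t') \<in> Q \<and>
        ((d' = d \<and> tri_adj t t') \<or> (d' = \<alpha> d \<and> tri_adj t (gc_refl (gc_z k l) ` t'))))"

end

theory Submission
  imports Defs
begin

text \<open>If all face lengths are divisible by 3, then X covers the tetrahedron graph, compatibly with the cyclic
  orders: a plane map is simply connected, and the monodromy of the tetrahedron graph around every face of X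
  is trivial. Hence the triangles that make up a Goldberg--Coxeter graph of X develop into the plane,
  consistently up to the half-turns about the points of z Z[\<omega>], and a function on the unit triangles of
  the plane that is invariant under these half-turns descends to the Goldberg--Coxeter graph. For z = k and
  z = k + k \<omega> it suffices that the function is invariant under the half-turns about the points of
  k Z[\<omega>].

  Let the value at the upward triangle in position (a, b) be \<open>(-1)^a * g b\<close> and let it be
  \<open>\<mu> * (-1)^a * g (b + 1)\<close> at the downward triangle, where \<open>\<mu> = 1\<close> or \<open>\<mu> = -1\<close>. For every function g on
  the integers this is an eigenfunction of the adjacency operator for \<open>\<mu>\<close>, that is of the Laplacian for
  \<open>3 - \<mu>\<close>. It is invariant if g has period 2k and \<open>g (- b) = - \<mu> * g b\<close>. This gives multiplicity at
  least k + 1 for the eigenvalue 4 and at least k - 1 for the eigenvalue 2.\<close>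

section \<open>Components of relations and orbits\<close>

text \<open>The product of the order-3 rotation of T with the half-turn about the midpoint of a side
  is the rotation by 60 degrees about a corner of T. A loop around a face of length n therefore
  develops into a rotation by 60 n degrees, and divisibility by 3 leaves only half-turns. Modulo the
  half-turns about corners, the group of all these rotations becomes the rotation group of the
  tetrahedron. It has order 12, one element for each dart of the tetrahedron graph.

  Planarity is given only through Euler's formula. The passage from trivial monodromy around faces
  to trivial monodromy is therefore made by counting components, with nonnegativity of the genus as
  the key inequality.

  The other obstacle is the quotient that defines the graph. For z = k + k \<omega> triangles
  centred on a side of T occur in two copies, and the gluing could conceivably make neighbours
  coincide. Each vertex is therefore studied in the plane of one copy with the three copies attached
  to it, and a colouring with four colours shows that a vertex and its neighbours stay
  distinct.\<close>

definition eqcl :: "('a \<times> 'a) set \<Rightarrow> ('a \<times> 'a) set" where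
  "eqcl R = (R \<union> R\<inverse>)\<^sup>*"

definition n_comps :: "'a set \<Rightarrow> ('a \<times> 'a) set \<Rightarrow> nat" where
  "n_comps X R = card ((\<lambda>x. eqcl R `` {x}) ` X)"

definition graph_rel :: "'a set \<Rightarrow> ('a \<Rightarrow> 'a) \<Rightarrow> ('a \<times> 'a) set" where
  "graph_rel X f = {(x, f x) | x. x \<in> X}"

lemma eqcl_refl [simp, intro]: "(x, x) \<in> eqcl R"
  by (simp add: eqcl_def)

lemma eqcl_sym: "(x, y) \<in> eqcl R \<Longrightarrow> (y, x) \<in> eqcl R"
proof -
  have "sym ((R \<union> R\<inverse>)\<^sup>*)" by (intro sym_rtrancl) (auto simp: sym_def)
  thus "(x, y) \<in> eqcl R \<Longrightarrow> (y, x) \<in> eqcl R" unfolding eqcl_def sym_def by blast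
qed

lemma eqcl_trans: "(x, y) \<in> eqcl R \<Longrightarrow> (y, z) \<in> eqcl R \<Longrightarrow> (x, z) \<in> eqcl R"
  unfolding eqcl_def by (rule rtrancl_trans)

lemma eqcl_base: "(x, y) \<in> R \<Longrightarrow> (x, y) \<in> eqcl R"
  by (auto simp: eqcl_def)

lemma equiv_eqcl: "equiv UNIV (eqcl R)"
  by (intro equivI refl_onI symI transI) (auto dest: eqcl_sym eqcl_trans)

lemma eqcl_least:
  assumes "equiv UNIV E" "R \<subseteq> E"
  shows "eqcl R \<subseteq> E"
proof -
  have E: "(x, x) \<in> E" "(x, y) \<in> E \<Longrightarrow> (y, x) \<in> E" "(x, y) \<in> E \<Longrightarrow> (y, z) \<in> E \<Longrightarrow> (x, z) \<in> E"
    for x y z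
    using assms(1) unfolding equiv_def by (auto dest: refl_onD symD transD)
  have "(x, y) \<in> E" if "(x, y) \<in> (R \<union> R\<inverse>)\<^sup>*" for x y
    using that
  proof (induction rule: rtrancl_induct)
    case (step y z)
    have "(y, z) \<in> E" using step.hyps(2) assms(2) E(2) by auto
    thus ?case using E(3) step.IH by blast
  qed (rule E(1))
  thus ?thesis by (auto simp: eqcl_def)
qed

lemma eqcl_subset_iff: "eqcl R \<subseteq> eqcl S \<longleftrightarrow> R \<subseteq> eqcl S"
proof
  show "R \<subseteq> eqcl S" if "eqcl R \<subseteq> eqcl S" using that by (auto intro: eqcl_base)
qed (rule eqcl_least[OF equiv_eqcl])

lemma eqcl_image_eq_iff: "eqcl R `` {x} = eqcl R `` {y} \<longleftrightarrow> (x, y) \<in> eqcl R"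
  using eq_equiv_class_iff[OF equiv_eqcl] by simp

text \<open>A chain that uses the new pair several times can be shortened to a single use, so the
  right-hand side is already an equivalence.\<close>

lemma eqcl_insert:
  "eqcl (insert (x, y) R) =
     {(w, v). (w, v) \<in> eqcl R \<or> (w, x) \<in> eqcl R \<and> (y, v) \<in> eqcl R
            \<or> (w, y) \<in> eqcl R \<and> (x, v) \<in> eqcl R}" (is "_ = ?E")
proof
  have "equiv UNIV ?E"
    by (intro equivI) (auto simp: refl_on_def sym_def trans_def intro: eqcl_sym eqcl_trans)
  thus "eqcl (insert (x, y) R) \<subseteq> ?E"
    by (rule eqcl_least) (auto intro: eqcl_base)
  have 1: "eqcl R \<subseteq> eqcl (insert (x, y) R)"
    unfolding eqcl_subset_iff by (auto intro: eqcl_base)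
  have 2: "(x, y) \<in> eqcl (insert (x, y) R)" by (auto intro: eqcl_base)
  have 3: "(w, v) \<in> eqcl (insert (x, y) R)" if "(w, v) \<in> eqcl R" for w v
    using 1 that by blast
  show "?E \<subseteq> eqcl (insert (x, y) R)"
    by (auto intro: 3 eqcl_trans[OF 3 eqcl_trans[OF 2 3]]
        eqcl_trans[OF 3 eqcl_trans[OF eqcl_sym[OF 2] 3]])
qed

lemma n_comps_cong: "eqcl R = eqcl S \<Longrightarrow> n_comps X R = n_comps X S"
  by (simp add: n_comps_def)

lemma n_comps_insert_same:
  assumes "(x, y) \<in> eqcl R"
  shows "n_comps X (insert (x, y) R) = n_comps X R"
proof (rule n_comps_cong)
  show "eqcl (insert (x, y) R) = eqcl R"
    unfolding eqcl_insert using assms by (auto; meson eqcl_sym eqcl_trans)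
qed

lemma n_comps_insert_diff:
  assumes "finite X" "x \<in> X" "y \<in> X" "(x, y) \<notin> eqcl R"
  shows "n_comps X R = Suc (n_comps X (insert (x, y) R))"
proof -
  define f where "f = (\<lambda>w. eqcl R `` {w})"
  define f' where "f' = (\<lambda>w. eqcl (insert (x, y) R) `` {w})"
  have f_eq: "f w = f v \<longleftrightarrow> (w, v) \<in> eqcl R" for w v
    by (simp add: f_def eqcl_image_eq_iff)
  have self: "w \<in> f w" for w by (auto simp: f_def)
  have f': "f' w = (if f w = f x \<or> f w = f y then f x \<union> f y else f w)" for w
    unfolding f'_def eqcl_insert f_eq unfolding f_def
    by (auto; meson eqcl_sym eqcl_trans)
  have img: "f' ` X = insert (f x \<union> f y) (f ` X - {f x, f y})"
    using assms(2,3) by (auto simp: f' image_iff)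
  have ne: "f x \<noteq> f y" using assms(4) f_eq by simp
  have notin: "f x \<union> f y \<notin> f ` X - {f x, f y}"
  proof
    assume "f x \<union> f y \<in> f ` X - {f x, f y}"
    then obtain w where w: "f x \<union> f y = f w" "f w \<noteq> f x" by auto
    have "x \<in> f w" using w self by blast
    hence "(w, x) \<in> eqcl R" by (simp add: f_def)
    thus False using w f_eq by blast
  qed
  have "card (f' ` X) = Suc (card (f ` X - {f x, f y}))"
    using img notin assms(1) by simp
  also have "card (f ` X - {f x, f y}) = card (f ` X) - 2"
    using ne assms(1-3) by (subst card_Diff_subset) auto
  finally have a: "card (f' ` X) = Suc (card (f ` X) - 2)" .
  have "card {f x, f y} \<le> card (f ` X)"
    using assms(1-3) by (intro card_mono) auto
  hence "card (f ` X) \<ge> 2" using ne by simp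
  thus ?thesis using a unfolding n_comps_def f_def f'_def by simp
qed

lemma n_comps_le_insert:
  assumes "finite X" "x \<in> X" "y \<in> X"
  shows "n_comps X R \<le> Suc (n_comps X (insert (x, y) R))"
  using n_comps_insert_diff[OF assms] n_comps_insert_same[of x y R X] by (metis le_SucI order_refl)

section \<open>Iterates and orbits of permutations of a finite set\<close>

lemma funpow_in: "bij_betw f X X \<Longrightarrow> x \<in> X \<Longrightarrow> (f ^^ n) x \<in> X"
  by (induction n) (auto dest: bij_betwE)

lemma funpow_cancel:
  assumes "bij_betw f X X" "x \<in> X" "(f ^^ (i + n)) x = (f ^^ i) x"
  shows "(f ^^ n) x = x"
  using assms(3)
proof (induction i)
  case (Suc i)
  have "inj_on f X" using assms(1) by (simp add: bij_betw_def)
  moreover have "f ((f ^^ (i + n)) x) = f ((f ^^ i) x)" using Suc.prems by simp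
  ultimately show ?case
    using Suc.IH funpow_in[OF assms(1,2)] by (meson inj_onD)
qed simp

lemma funpow_period:
  assumes "finite X" "bij_betw f X X" "x \<in> X"
  obtains n where "n > 0" "(f ^^ n) x = x"
proof -
  have "(\<lambda>i. (f ^^ i) x) ` UNIV \<subseteq> X" using funpow_in[OF assms(2,3)] by auto
  hence "\<not> inj (\<lambda>i. (f ^^ i) x)" using assms(1) finite_imageD finite_subset infinite_UNIV_nat by blast
  then obtain i j where ij: "i < j" "(f ^^ i) x = (f ^^ j) x"
    by (metis (no_types, lifting) injI linorder_neqE_nat)
  hence "(f ^^ (i + (j - i))) x = (f ^^ i) x" by simp
  from funpow_cancel[OF assms(2,3) this] ij(1) show ?thesis by (intro that[of "j - i"]) auto
qed

lemma orb_eq_eqcl: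
  assumes "finite X" "bij_betw f X X" "x \<in> X"
  shows "orb f x = eqcl (graph_rel X f) `` {x}"
proof
  have "(x, (f ^^ n) x) \<in> eqcl (graph_rel X f)" for n
  proof (induction n)
    case (Suc n)
    have "((f ^^ n) x, f ((f ^^ n) x)) \<in> graph_rel X f"
      using funpow_in[OF assms(2,3)] by (auto simp: graph_rel_def)
    thus ?case using Suc eqcl_base eqcl_trans by (metis comp_apply funpow.simps(2))
  qed simp
  thus "orb f x \<subseteq> eqcl (graph_rel X f) `` {x}" by (auto simp: orb_def)
  obtain m where m: "m > 0" "(f ^^ m) x = x" using funpow_period[OF assms] .
  have "y \<in> orb f x" if "(x, y) \<in> (graph_rel X f \<union> (graph_rel X f)\<inverse>)\<^sup>*" for y
    using that
  proof (induction rule: rtrancl_induct)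
    case base
    show ?case by (auto simp: orb_def intro: exI[of _ 0])
  next
    case (step w v)
    from step.IH obtain n where n: "w = (f ^^ n) x" by (auto simp: orb_def)
    \<comment> \<open>A backward step needs a positive exponent, so 0 is traded for the period
      \<open>m\<close>.\<close>
    define n' where "n' = (if n = 0 then m else n)"
    have n': "w = (f ^^ n') x" "n' > 0" using n m by (auto simp: n'_def)
    from step.hyps(2) consider "v = f w" | "v \<in> X" "w = f v" by (auto simp: graph_rel_def)
    thus ?case
    proof cases
      case 1
      hence "v = (f ^^ Suc n) x" using n by simp
      thus ?thesis unfolding orb_def by blast
    next
      case 2
      have "f v = f ((f ^^ (n' - 1)) x)"
        using n' 2 by (cases n') auto
      hence "v = (f ^^ (n' - 1)) x"
        using 2(1) funpow_in[OF assms(2,3)] assms(2) by (meson bij_betw_def inj_onD)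
      thus ?thesis unfolding orb_def by blast
    qed
  qed
  thus "eqcl (graph_rel X f) `` {x} \<subseteq> orb f x" by (auto simp: eqcl_def)
qed

lemma card_orb_image:
  assumes "finite X" "bij_betw f X X"
  shows "card (orb f ` X) = n_comps X (graph_rel X f)"
proof -
  have "orb f ` X = (\<lambda>x. eqcl (graph_rel X f) `` {x}) ` X"
    using orb_eq_eqcl[OF assms] by (intro image_cong) auto
  thus ?thesis by (simp add: n_comps_def)
qed

section \<open>Nonnegativity of the genus\<close>

lemma eqcl_transposition:
  assumes "x \<in> X" "y \<in> X" "p' x = p y" "p' y = p x"
    "\<And>w. w \<in> X \<Longrightarrow> w \<noteq> x \<Longrightarrow> w \<noteq> y \<Longrightarrow> p' w = p w"
  shows "eqcl (insert (x, y) (graph_rel X p')) \<subseteq> eqcl (insert (x, y) (graph_rel X p))"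
  unfolding eqcl_subset_iff
proof
  let ?E = "eqcl (insert (x, y) (graph_rel X p))"
  have xy: "(x, y) \<in> ?E" by (auto intro: eqcl_base)
  have p: "(w, p w) \<in> ?E" if "w \<in> X" for w
    using that by (intro eqcl_base) (auto simp: graph_rel_def)
  fix e assume "e \<in> insert (x, y) (graph_rel X p')"
  then consider "e = (x, y)" | w where "w \<in> X" "e = (w, p' w)" by (auto simp: graph_rel_def)
  thus "e \<in> ?E"
  proof cases
    case 2
    show ?thesis
    proof (cases "w = x \<or> w = y")
      case True
      thus ?thesis
        using 2 assms(1-4) p[of x] p[of y] eqcl_trans[OF xy] eqcl_trans[OF eqcl_sym[OF xy]] by auto
    next
      case False
      thus ?thesis using 2 assms p by auto
    qed
  qed (simp add: xy)
qed

text \<open>Composition with a transposition splits one cycle or joins two. Both cases compare with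
  the relation in which x and y are linked, where \<open>p\<close> and \<open>p'\<close> have the
  same classes.\<close>

lemma n_comps_transposition:
  assumes X: "finite X" and p: "bij_betw p X X" and xy: "x \<in> X" "y \<in> X"
    and p': "p' x = p y" "p' y = p x"
    "\<And>w. w \<in> X \<Longrightarrow> w \<noteq> x \<Longrightarrow> w \<noteq> y \<Longrightarrow> p' w = p w"
  shows "(x, y) \<in> eqcl (graph_rel X p) \<Longrightarrow>
           n_comps X (graph_rel X p') \<le> Suc (n_comps X (graph_rel X p))"
    and "(x, y) \<notin> eqcl (graph_rel X p) \<Longrightarrow>
           Suc (n_comps X (graph_rel X p')) = n_comps X (graph_rel X p)"
proof -
  let ?R = "graph_rel X p" and ?R' = "graph_rel X p'"
  have "eqcl (insert (x, y) ?R') = eqcl (insert (x, y) ?R)"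
    by (intro equalityI eqcl_transposition) (use xy p' in auto)
  hence eq: "n_comps X (insert (x, y) ?R') = n_comps X (insert (x, y) ?R)"
    by (rule n_comps_cong)
  show "n_comps X ?R' \<le> Suc (n_comps X ?R)" if "(x, y) \<in> eqcl ?R"
    using n_comps_le_insert[OF X xy, of ?R'] eq n_comps_insert_same[OF that, of X] by simp
  show "Suc (n_comps X ?R') = n_comps X ?R" if ne: "(x, y) \<notin> eqcl ?R"
  proof -
    obtain m where m: "m > 0" "(p ^^ m) y = y" using funpow_period[OF X p xy(2)] .
    have in_orb: "(y, (p ^^ i) y) \<in> eqcl ?R" for i
      using orb_eq_eqcl[OF X p xy(2)] by (auto simp: orb_def)
    have step: "(w, p' w) \<in> eqcl ?R'" if "w \<in> X" for w
      using that by (intro eqcl_base) (auto simp: graph_rel_def)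
    \<comment> \<open>From x, \<open>p'\<close> jumps to \<open>p y\<close> and then follows the old
      cycle of y, which avoids x, until it arrives at y.\<close>
    have "(x, (p ^^ Suc i) y) \<in> eqcl ?R' \<or> (x, y) \<in> eqcl ?R'" for i
    proof (induction i)
      case 0
      show ?case using step[OF xy(1)] p'(1) by simp
    next
      case (Suc i)
      let ?w = "(p ^^ Suc i) y"
      have "?w \<noteq> x" using ne in_orb[of "Suc i"] eqcl_sym by metis
      moreover have w: "?w \<in> X" using funpow_in[OF p xy(2)] .
      ultimately have "?w = y \<or> p' ?w = (p ^^ Suc (Suc i)) y" using p'(3)[OF w] by (cases "?w = y") simp_all
      thus ?case using Suc step[OF w] eqcl_trans by metis
    qed
    from this[of "m - 1"] m have "(x, y) \<in> eqcl ?R'" by auto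
    from n_comps_insert_same[OF this, of X] n_comps_insert_diff[OF X xy ne] eq
    show ?thesis by simp
  qed
qed

text \<open>The genus inequality, for the involution restricted to a union E of its cycles so that it can be
  proved by adding one transposition at a time.\<close>
lemma genus_inequality_aux:
  assumes X: "finite X" and s: "bij_betw s X X"
    and a: "\<And>x. x \<in> X \<Longrightarrow> a x \<in> X \<and> a x \<noteq> x \<and> a (a x) = x"
    and E: "E \<subseteq> X" "a ` E \<subseteq> E"
  defines "p \<equiv> \<lambda>E x. s (if x \<in> E then a x else x)"
  shows "2 * (n_comps X (graph_rel X s) + n_comps X (graph_rel X (p E)))
    \<le> card E + 4 * n_comps X (graph_rel X s \<union> graph_rel E a)"
  using E
proof (induction "card E" arbitrary: E rule: less_induct)
  case less
  show ?case
  proof (cases "E = {}")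
    case True
    thus ?thesis by (simp add: p_def graph_rel_def)
  next
    case False
    then obtain x where xE: "x \<in> E" by auto
    define y where "y = a x"
    define E' where "E' = E - {x, y}"
    have x: "x \<in> X" and yE: "y \<in> E" and y: "y \<in> X" and ay: "a y = x" and xy: "x \<noteq> y"
      using less.prems xE a[of x] by (auto simp: y_def)
    have finE: "finite E" using less.prems(1) X finite_subset by blast
    have cardE: "card E = card E' + 2"
    proof -
      have "E = insert x (insert y E')" using xE yE by (auto simp: E'_def)
      moreover have "x \<notin> insert y E'" "y \<notin> E'" using xy by (auto simp: E'_def)
      moreover have "finite E'" using finE by (simp add: E'_def)
      ultimately show ?thesis by simp
    qed
    have E'X: "E' \<subseteq> X" using less.prems by (auto simp: E'_def)
    have aE': "a ` E' \<subseteq> E'"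
    proof
      fix w assume "w \<in> a ` E'"
      then obtain v where v: "v \<in> E" "v \<noteq> x" "v \<noteq> y" "w = a v" by (auto simp: E'_def)
      have "a w = v" using v a less.prems(1) by auto
      thus "w \<in> E'" using v less.prems(2) ay y_def by (auto simp: E'_def)
    qed
    let ?J = "graph_rel X s \<union> graph_rel E a" and ?J' = "graph_rel X s \<union> graph_rel E' a"
    have IH: "2 * (n_comps X (graph_rel X s) + n_comps X (graph_rel X (p E')))
       \<le> card E' + 4 * n_comps X ?J'"
      using less.hyps[OF _ E'X aE'] cardE by simp
    define a' where "a' = (\<lambda>x. if x \<in> E' then a x else x)"
    have "bij_betw a' X X"
    proof (rule bij_betwI[where g = a'])
      show "a' \<in> X \<rightarrow> X" "a' \<in> X \<rightarrow> X" using a by (auto simp: a'_def)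
      show "a' (a' w) = w" "a' (a' w) = w" if "w \<in> X" for w
        using a that aE' by (auto simp: a'_def)
    qed
    hence "bij_betw (s \<circ> a') X X" using s by (rule bij_betw_trans)
    hence bij: "bij_betw (p E') X X" by (simp add: p_def a'_def comp_def)
    have p': "p E x = p E' y" "p E y = p E' x" 
      "\<And>w. w \<in> X \<Longrightarrow> w \<noteq> x \<Longrightarrow> w \<noteq> y \<Longrightarrow> p E w = p E' w"
      using xE yE ay by (auto simp: p_def E'_def y_def)
    have T: "(x, y) \<in> eqcl (graph_rel X (p E')) \<Longrightarrow>
        n_comps X (graph_rel X (p E)) \<le> Suc (n_comps X (graph_rel X (p E')))"
      "(x, y) \<notin> eqcl (graph_rel X (p E')) \<Longrightarrow>
        Suc (n_comps X (graph_rel X (p E))) = n_comps X (graph_rel X (p E'))"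
      by (rule n_comps_transposition[OF X bij x y]; use p' in simp)+
    have "?J = insert (y, x) (insert (x, y) ?J')"
      using xE yE ay by (auto simp: graph_rel_def E'_def y_def)
    moreover have "(y, x) \<in> eqcl (insert (x, y) ?J')"
      by (intro eqcl_sym[of x y] eqcl_base) simp
    ultimately have J: "n_comps X ?J = n_comps X (insert (x, y) ?J')"
      by (simp add: n_comps_insert_same)
    show ?thesis
    proof (cases "(x, y) \<in> eqcl (graph_rel X (p E'))")
      case True
      \<comment> \<open>Both ends of the edge lie on one face. The edge may split this face, but it
        joins no components, since a face stays inside one component.\<close>
      have "graph_rel X (p E') \<subseteq> eqcl ?J'"
      proof
        fix e assume "e \<in> graph_rel X (p E')"
        then obtain w where w: "w \<in> X" "e = (w, p E' w)" by (auto simp: graph_rel_def)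
        have st: "(v, s v) \<in> eqcl ?J'" if "v \<in> X" for v
          using that by (intro eqcl_base) (auto simp: graph_rel_def)
        have "(w, a w) \<in> eqcl ?J'" if "w \<in> E'"
          using that by (intro eqcl_base) (auto simp: graph_rel_def)
        thus "e \<in> eqcl ?J'" using st w a by (auto simp: p_def intro: eqcl_trans)
      qed
      hence "(x, y) \<in> eqcl ?J'" using True eqcl_subset_iff by blast
      hence "n_comps X ?J = n_comps X ?J'" using J n_comps_insert_same by metis
      with IH T(1)[OF True] cardE show ?thesis by presburger
    next
      case False
      \<comment> \<open>The ends lie on different faces, which become one. The left side drops by 2;
        the right side gains 2 from the darts and loses at most 4 from the components.\<close>
      have "n_comps X ?J' \<le> Suc (n_comps X ?J)" using n_comps_le_insert[OF X x y] J by metis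
      with IH T(2)[OF False] cardE show ?thesis by presburger
    qed
  qed
qed

text \<open>Since \<open>card X\<close> is twice the number of edges, this is twice V - E + F \<le>
  2 C, where C counts the components.\<close>

lemma genus_inequality:
  assumes X: "finite X" and s: "bij_betw s X X"
    and a: "\<And>x. x \<in> X \<Longrightarrow> a x \<in> X \<and> a x \<noteq> x \<and> a (a x) = x"
  shows "2 * (card (orb s ` X) + card (orb (s \<circ> a) ` X))
    \<le> card X + 4 * n_comps X (graph_rel X s \<union> graph_rel X a)"
proof -
  have "bij_betw a X X"
    by (rule bij_betwI[where g = a]) (use a in auto)
  hence "bij_betw (s \<circ> a) X X" using s by (rule bij_betw_trans)
  moreover have "graph_rel X (\<lambda>x. s (if x \<in> X then a x else x)) = graph_rel X (s \<circ> a)"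
    by (auto simp: graph_rel_def)
  ultimately show ?thesis
    using genus_inequality_aux[OF X s a, of X] a X s by (auto simp: card_orb_image)
qed

section \<open>Lifting planar maps\<close>

lemma card_orb_eq_period:
  assumes "finite X" "bij_betw f X X" "x \<in> X"
  shows "card (orb f x) > 0" "(f ^^ n) x = x \<Longrightarrow> card (orb f x) dvd n"
proof -
  define P where "P = (\<lambda>n. n > 0 \<and> (f ^^ n) x = x)"
  define m where "m = (LEAST n. P n)"
  obtain n0 where "P n0" using funpow_period[OF assms] by (auto simp: P_def)
  hence "P m" unfolding m_def by (rule LeastI)
  hence m: "m > 0" "(f ^^ m) x = x" by (auto simp: P_def)
  have least: "\<not> P n" if "n < m" for n using that not_less_Least unfolding m_def by blast
  have md: "(f ^^ n) x = (f ^^ (n mod m)) x" for n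
    using m(2) by (metis funpow_mod_eq)
  have orb: "orb f x = (\<lambda>i. (f ^^ i) x) ` {..<m}"
    using md m(1) by (auto simp: orb_def image_iff) (metis lessThan_iff mod_less_divisor)
  have inj: "inj_on (\<lambda>i. (f ^^ i) x) {..<m}"
  proof (rule linorder_inj_onI)
    fix i j assume ij: "i < j" "i \<in> {..<m}" "j \<in> {..<m}"
    show "(f ^^ i) x \<noteq> (f ^^ j) x"
    proof
      assume "(f ^^ i) x = (f ^^ j) x"
      hence "(f ^^ (i + (j - i))) x = (f ^^ i) x" using ij by simp
      from funpow_cancel[OF assms(2,3) this] have "P (j - i)" using ij by (simp add: P_def)
      thus False using least ij by (meson lessThan_iff less_imp_diff_less)
    qed
  qed auto
  have card: "card (orb f x) = m" unfolding orb by (subst card_image[OF inj]) simp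
  thus "card (orb f x) > 0" using m by simp
  show "card (orb f x) dvd n" if "(f ^^ n) x = x"
  proof -
    have "(f ^^ (n mod m)) x = x" using that md by metis
    hence "\<not> n mod m > 0" using least[of "n mod m"] m(1) by (auto simp: P_def)
    thus ?thesis using card by auto
  qed
qed

text \<open>An orbit of c points receives c times 1/c. In this form orbits of different maps are
  compared point by point, without a bijection between them.\<close>

lemma card_orbits_eq_sum:
  assumes "finite X" "bij_betw f X X"
  shows "real (card (orb f ` X)) = (\<Sum>x\<in>X. 1 / real (card (orb f x)))"
proof -
  have eq: "orb f y = orb f x \<longleftrightarrow> y \<in> orb f x" if "x \<in> X" "y \<in> X" for x y
    using orb_eq_eqcl[OF assms that(1)] orb_eq_eqcl[OF assms that(2)]
    by (metis Image_singleton_iff eqcl_image_eq_iff)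
  have sub: "orb f x \<subseteq> X" if "x \<in> X" for x
    using funpow_in[OF assms(2) that] by (auto simp: orb_def)
  have fin: "finite (orb f x)" if "x \<in> X" for x
    using finite_subset[OF sub[OF that] assms(1)] .
  have "(\<Sum>x\<in>X. 1 / real (card (orb f x)))
      = (\<Sum>Q\<in>orb f ` X. \<Sum>x\<in>{x \<in> X. orb f x = Q}. 1 / real (card (orb f x)))"
    by (rule sum.image_gen[OF assms(1)])
  also have "\<dots> = (\<Sum>Q\<in>orb f ` X. 1)"
  proof (rule sum.cong)
    fix Q assume "Q \<in> orb f ` X"
    then obtain x where x: "x \<in> X" "Q = orb f x" by auto
    have "{x \<in> X. orb f x = Q} = Q" using eq sub[OF x(1)] x by auto
    thus "(\<Sum>x\<in>{x \<in> X. orb f x = Q}. 1 / real (card (orb f x))) = 1"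
      using card_orb_eq_period(1)[OF assms x(1)] eq[OF x(1) subsetD[OF sub[OF x(1)]]] x(2)
      by (subst sum.cong[OF refl, where h = "\<lambda>_. 1 / real (card Q)"]) auto
  qed simp
  finally show ?thesis by simp
qed

lemma funpow_map_prod:
  fixes f :: "'a \<Rightarrow> 'a" and g :: "'b \<Rightarrow> 'b"
  shows "(map_prod f g ^^ n) (x, y) = ((f ^^ n) x, (g ^^ n) y)"
  by (induction n arbitrary: x y) simp_all

text \<open>Whenever f has gone once around its orbit, g is back at its starting point. So every
  orbit of the product projects bijectively onto an orbit of f.\<close>

lemma card_orbits_prod:
  assumes X: "finite X" "bij_betw f X X" and K: "finite K" "bij_betw g K K"
    and per: "\<And>x \<kappa>. x \<in> X \<Longrightarrow> \<kappa> \<in> K \<Longrightarrow> (g ^^ card (orb f x)) \<kappa> = \<kappa>"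
  shows "card (orb (map_prod f g) ` (X \<times> K)) = card K * card (orb f ` X)"
proof -
  let ?h = "map_prod f g"
  have bij: "bij_betw ?h (X \<times> K) (X \<times> K)" using bij_betw_map_prod[OF X(2) K(2)] .
  have card_eq: "card (orb ?h (x, \<kappa>)) = card (orb f x)" if xk: "x \<in> X" "\<kappa> \<in> K" for x \<kappa>
  proof -
    have *: "(g ^^ i) \<kappa> = (g ^^ j) \<kappa>" if ij: "i \<le> j" "(f ^^ i) x = (f ^^ j) x" for i j
    proof -
      have "(f ^^ (i + (j - i))) x = (f ^^ i) x" using ij by simp
      from funpow_cancel[OF X(2) xk(1) this]
      have "card (orb f x) dvd j - i" by (rule card_orb_eq_period(2)[OF X xk(1)])
      then obtain c where c: "j = i + card (orb f x) * c" using ij by (metis dvd_def le_add_diff_inverse)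
      have "((g ^^ card (orb f x)) ^^ c) \<kappa> = \<kappa>"
        by (induction c) (use per[OF xk] in auto)
      hence "(g ^^ (card (orb f x) * c)) \<kappa> = \<kappa>" by (metis funpow_mult mult.commute)
      thus ?thesis by (simp add: c funpow_add)
    qed
    have "inj_on fst (orb ?h (x, \<kappa>))"
      using * by (auto simp: inj_on_def orb_def funpow_map_prod) (metis nat_le_linear)
    moreover have "fst ` orb ?h (x, \<kappa>) = orb f x"
      by (auto simp: orb_def funpow_map_prod image_iff) 
    ultimately show ?thesis using card_image by metis
  qed
  have "real (card (orb ?h ` (X \<times> K))) = (\<Sum>(x, \<kappa>)\<in>X \<times> K. 1 / real (card (orb f x)))"
    using card_orbits_eq_sum[OF _ bij] X K card_eq
    by (simp add: case_prod_beta) (intro sum.cong, auto)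
  also have "\<dots> = real (card K) * (\<Sum>x\<in>X. 1 / real (card (orb f x)))"
    by (simp add: sum.cartesian_product[symmetric] sum_distrib_left)
  also have "\<dots> = real (card K) * real (card (orb f ` X))"
    using card_orbits_eq_sum[OF X] by simp
  finally show ?thesis by (metis of_nat_eq_iff of_nat_mult)
qed

lemma card_orbits_involution:
  assumes X: "finite X" and a: "\<And>x. x \<in> X \<Longrightarrow> a x \<in> X \<and> a x \<noteq> x \<and> a (a x) = x"
  shows "2 * card (orb a ` X) = card X"
proof -
  have bij: "bij_betw a X X"
    by (rule bij_betwI[where g = a]) (use a in auto)
  have card: "card (orb a x) = 2" if x: "x \<in> X" for x
  proof -
    have "(a ^^ n) x \<in> {x, a x}" for n
      by (induction n) (use a x in auto)
    moreover have "x = (a ^^ 0) x" "a x = (a ^^ 1) x" by auto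
    ultimately have "orb a x = {x, a x}" unfolding orb_def by blast
    thus ?thesis using a[OF x] by auto
  qed
  have "real (card (orb a ` X)) = real (card X) / 2"
    using card_orbits_eq_sum[OF X bij] card by simp
  thus ?thesis by linarith
qed

text \<open>A plane map is simply connected. The product of the map with the fibre \<open>K\<close> has Euler
  characteristic \<open>2 * card K\<close>, hence at least \<open>card K\<close> components because no component has negative
  genus. Every component surjects onto \<open>D\<close>, so each is the graph of a section.\<close>
theorem plane_map_section:
  assumes fin: "finite D" and bij: "bij_betw \<sigma> D D"
    and inv: "\<And>d. d \<in> D \<Longrightarrow> \<alpha> d \<in> D \<and> \<alpha> d \<noteq> d \<and> \<alpha> (\<alpha> d) = d"
    and conn: "\<And>d d'. d \<in> D \<Longrightarrow> d' \<in> D \<Longrightarrow> (d, d') \<in> (graph_rel D \<sigma> \<union> graph_rel D \<alpha>)\<^sup>*"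
    and euler: "int (card (orb \<sigma> ` D)) - int (card (orb \<alpha> ` D)) + int (card (orb (\<sigma> \<circ> \<alpha>) ` D)) = 2"
    and K: "finite K" "bij_betw s K K"
    and a: "\<And>\<kappa>. \<kappa> \<in> K \<Longrightarrow> a \<kappa> \<in> K \<and> a (a \<kappa>) = \<kappa>"
    and per_s: "\<And>d \<kappa>. d \<in> D \<Longrightarrow> \<kappa> \<in> K \<Longrightarrow> (s ^^ card (orb \<sigma> d)) \<kappa> = \<kappa>"
    and per_sa: "\<And>d \<kappa>. d \<in> D \<Longrightarrow> \<kappa> \<in> K \<Longrightarrow> ((s \<circ> a) ^^ card (orb (\<sigma> \<circ> \<alpha>) d)) \<kappa> = \<kappa>"
    and base: "d0 \<in> D" "\<kappa>0 \<in> K"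
  obtains \<pi> where "\<pi> d0 = \<kappa>0" "\<And>d. d \<in> D \<Longrightarrow> \<pi> d \<in> K"
    "\<And>d. d \<in> D \<Longrightarrow> \<pi> (\<sigma> d) = s (\<pi> d)" "\<And>d. d \<in> D \<Longrightarrow> \<pi> (\<alpha> d) = a (\<pi> d)"
proof -
  let ?X = "D \<times> K" and ?s = "map_prod \<sigma> s" and ?a = "map_prod \<alpha> a"
  let ?R = "graph_rel ?X ?s \<union> graph_rel ?X ?a"
  have bij_\<alpha>: "bij_betw \<alpha> D D" by (rule bij_betwI[where g = \<alpha>]) (use inv in auto)
  have bij_a: "bij_betw a K K" by (rule bij_betwI[where g = a]) (use a in auto)
  have finX: "finite ?X" using fin K by simp
  \<comment> \<open>The product involution has no fixed points because \<alpha> has none;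
    \<open>a\<close> is allowed to fix points of the fibre.\<close>
  have "2 * (card (orb ?s ` ?X) + card (orb (?s \<circ> ?a) ` ?X)) \<le> card ?X + 4 * n_comps ?X ?R"
    by (rule genus_inequality[OF finX bij_betw_map_prod[OF bij K(2)]]) (use a inv in auto)
  moreover have "card (orb ?s ` ?X) = card K * card (orb \<sigma> ` D)"
    by (rule card_orbits_prod[OF fin bij K per_s])
  moreover have "?s \<circ> ?a = map_prod (\<sigma> \<circ> \<alpha>) (s \<circ> a)" by (simp add: map_prod_compose)
  moreover have "card (orb (map_prod (\<sigma> \<circ> \<alpha>) (s \<circ> a)) ` ?X) = card K * card (orb (\<sigma> \<circ> \<alpha>) ` D)"
    by (rule card_orbits_prod[OF fin bij_betw_trans[OF bij_\<alpha> bij] K(1)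
          bij_betw_trans[OF bij_a K(2)] per_sa])
  moreover have "card ?X = card K * (2 * card (orb \<alpha> ` D))"
    using card_orbits_involution[OF fin inv] by (simp add: card_cartesian_product mult.commute)
  ultimately have ineq: "2 * (card K * card (orb \<sigma> ` D) + card K * card (orb (\<sigma> \<circ> \<alpha>) ` D))
      \<le> card K * (2 * card (orb \<alpha> ` D)) + 4 * n_comps ?X ?R"
    by simp
  have V: "card (orb \<sigma> ` D) + card (orb (\<sigma> \<circ> \<alpha>) ` D) = 2 + card (orb \<alpha> ` D)"
    using euler by linarith
  have eq: "card K * card (orb \<sigma> ` D) + card K * card (orb (\<sigma> \<circ> \<alpha>) ` D)
      = 2 * card K + card K * card (orb \<alpha> ` D)"
    unfolding distrib_left[symmetric] V by simp
  have "K \<le> N" if "2 * A \<le> K * (2 * C) + 4 * N" "A = 2 * K + K * C" for A C K N :: nat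
    using that by simp
  from this[OF ineq eq] have comps: "card K \<le> n_comps ?X ?R" .

  define cls where "cls = (\<lambda>x. eqcl ?R `` {x})"
  have st: "((d, \<kappa>), (\<sigma> d, s \<kappa>)) \<in> eqcl ?R" "((d, \<kappa>), (\<alpha> d, a \<kappa>)) \<in> eqcl ?R"
    if "d \<in> D" "\<kappa> \<in> K" for d \<kappa>
    using that by (auto intro!: eqcl_base simp: graph_rel_def image_iff)
  have s_in: "s \<kappa> \<in> K" if "\<kappa> \<in> K" for \<kappa> using K(2) that bij_betwE by blast
  have reach: "\<exists>\<kappa>'\<in>K. ((d, \<kappa>), (d', \<kappa>')) \<in> eqcl ?R"
    if "(d, d') \<in> (graph_rel D \<sigma> \<union> graph_rel D \<alpha>)\<^sup>*" "\<kappa> \<in> K" for d d' \<kappa>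
    using that
  proof (induction rule: rtrancl_induct)
    case (step y z)
    then obtain \<kappa>' where k: "\<kappa>' \<in> K" "((d, \<kappa>), (y, \<kappa>')) \<in> eqcl ?R" by blast
    from step.hyps(2) have "y \<in> D" "z = \<sigma> y \<or> z = \<alpha> y" by (auto simp: graph_rel_def)
    thus ?case
      using s_in[OF k(1)] a[OF k(1)] eqcl_trans[OF k(2) st(1)[OF _ k(1)]]
        eqcl_trans[OF k(2) st(2)[OF _ k(1)]] by auto
  qed auto
  have uniq: "\<kappa> = \<kappa>'" if "((d, \<kappa>), (d, \<kappa>')) \<in> eqcl ?R" "d \<in> D" "\<kappa> \<in> K" "\<kappa>' \<in> K" for d \<kappa> \<kappa>'
  proof -
    \<comment> \<open>By connectedness every component meets the fibre over d. As there are at least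
      \<open>card K\<close> components, no two points of this fibre share one.\<close>
    have "cls ` ?X \<subseteq> (\<lambda>\<kappa>. cls (d, \<kappa>)) ` K"
    proof
      fix c assume "c \<in> cls ` ?X"
      then obtain d1 \<kappa>1 where 1: "d1 \<in> D" "\<kappa>1 \<in> K" "c = cls (d1, \<kappa>1)" by auto
      from reach[OF conn[OF 1(1) that(2)] 1(2)] obtain \<kappa>2
        where 2: "\<kappa>2 \<in> K" "((d1, \<kappa>1), (d, \<kappa>2)) \<in> eqcl ?R" by blast
      have "c = cls (d, \<kappa>2)" unfolding 1(3) cls_def eqcl_image_eq_iff by (rule 2(2))
      thus "c \<in> (\<lambda>\<kappa>. cls (d, \<kappa>)) ` K" using 2(1) by blast
    qed
    hence "card K \<le> card ((\<lambda>\<kappa>. cls (d, \<kappa>)) ` K)"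
      using comps K(1) unfolding n_comps_def cls_def
      by (meson card_mono finite_imageI le_trans)
    hence "inj_on (\<lambda>\<kappa>. cls (d, \<kappa>)) K"
      using K(1) by (meson card_image_le eq_card_imp_inj_on le_antisym)
    moreover have "cls (d, \<kappa>) = cls (d, \<kappa>')" 
      unfolding cls_def eqcl_image_eq_iff by (rule that(1))
    ultimately show ?thesis using that by (meson inj_onD)
  qed
  define \<pi> where "\<pi> = (\<lambda>d. SOME \<kappa>. \<kappa> \<in> K \<and> ((d0, \<kappa>0), (d, \<kappa>)) \<in> eqcl ?R)"
  have \<pi>: "\<pi> d \<in> K" "((d0, \<kappa>0), (d, \<pi> d)) \<in> eqcl ?R" if "d \<in> D" for d
    using someI_ex[of "\<lambda>\<kappa>. \<kappa> \<in> K \<and> ((d0, \<kappa>0), (d, \<kappa>)) \<in> eqcl ?R"]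
      reach[OF conn[OF base(1) that] base(2)] unfolding \<pi>_def by blast+
  have eqI: "\<pi> d = \<kappa>" if "d \<in> D" "\<kappa> \<in> K" "((d0, \<kappa>0), (d, \<kappa>)) \<in> eqcl ?R" for d \<kappa>
    using uniq[OF eqcl_trans[OF eqcl_sym[OF \<pi>(2)[OF that(1)]] that(3)] that(1) \<pi>(1)[OF that(1)] that(2)] .
  have \<sigma>_in: "\<sigma> d \<in> D" if "d \<in> D" for d using bij that bij_betwE by blast
  show ?thesis
  proof (rule that)
    show "\<pi> d0 = \<kappa>0" using eqI base by auto
    show "\<pi> d \<in> K" if "d \<in> D" for d using \<pi> that by blast
    show "\<pi> (\<sigma> d) = s (\<pi> d)" if "d \<in> D" for d
      by (rule eqI[OF \<sigma>_in[OF that] s_in[OF \<pi>(1)[OF that]]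
            eqcl_trans[OF \<pi>(2)[OF that] st(1)[OF that \<pi>(1)[OF that]]]])
    show "\<pi> (\<alpha> d) = a (\<pi> d)" if "d \<in> D" for d
      using eqI[OF _ _ eqcl_trans[OF \<pi>(2)[OF that] st(2)[OF that \<pi>(1)[OF that]]]] inv[OF that]
        a[OF \<pi>(1)[OF that]] by blast
  qed
qed

section \<open>A lower bound for the multiplicity of an eigenvalue\<close>

lemma vector_space_fun:
  "vector_space (\<lambda>(c::complex) (f :: 'v \<Rightarrow> complex) x. c * f x)"
  by unfold_locales (auto simp: fun_eq_iff algebra_simps)

lemma sum_fun_eval: "(\<Sum>x\<in>A. (f x :: 'v \<Rightarrow> complex)) p = (\<Sum>x\<in>A. f x p)"
  by (induction A rule: infinite_finite_induct) auto

text \<open>Evaluation at the points \<open>P i\<close> gives a diagonal matrix without zeros on the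
  diagonal, so the functions are independent.\<close>

lemma card_le_lap_mult:
  assumes V: "finite V" and J: "finite J"
    and F: "\<And>j. j \<in> J \<Longrightarrow> F j \<in> lap_eigenspace V adj lam"
    and P: "\<And>i j. i \<in> J \<Longrightarrow> j \<in> J \<Longrightarrow> F j (P i) \<noteq> 0 \<longleftrightarrow> i = j"
  shows "card J \<le> lap_mult V adj lam"
proof -
  interpret vector_space "\<lambda>(c::complex) (f :: 'a \<Rightarrow> complex) x. c * f x"
    by (rule vector_space_fun)
  let ?W = "lap_eigenspace V adj lam"
  define \<delta> :: "'a \<Rightarrow> 'a \<Rightarrow> complex" where "\<delta> = (\<lambda>p x. if x = p then 1 else 0)"
  have W: "?W \<subseteq> span (\<delta> ` V)"
  proof
    fix f assume "f \<in> ?W"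
    hence f0: "f p = 0" if "p \<notin> V" for p using that by (auto simp: lap_eigenspace_def)
    have "f = (\<Sum>p\<in>V. (\<lambda>x. f p * \<delta> p x))"
    proof
      fix x
      show "f x = (\<Sum>p\<in>V. (\<lambda>x. f p * \<delta> p x)) x"
        using f0[of x] V by (simp add: sum_fun_eval \<delta>_def if_distrib[of "\<lambda>c. _ * c"] cong: if_cong)
    qed
    also have "\<dots> \<in> span (\<delta> ` V)"
      by (intro span_sum span_scale span_base) auto
    finally show "f \<in> span (\<delta> ` V)" .
  qed
  obtain B where B: "B \<subseteq> ?W" "independent B" "?W \<subseteq> span B" "card B = dim ?W"
    using basis_exists by blast
  \<comment> \<open>An infinite basis would have cardinality 0; the point masses at the vertices
    rule this out.\<close>
  have finB: "finite B"
    using independent_span_bound[OF _ B(2), of "\<delta> ` V"] B(1) W V by auto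
  have inj: "inj_on F J"
  proof (rule inj_onI)
    fix i j assume ij: "i \<in> J" "j \<in> J" "F i = F j"
    show "i = j" using P[OF ij(1) ij(1)] P[OF ij(1) ij(2)] ij(3) by simp
  qed
  have ind: "independent (F ` J)"
  proof (rule independent_if_scalars_zero)
    fix c f assume c: "(\<Sum>x\<in>F ` J. (\<lambda>p. c x * x p)) = 0" and "f \<in> F ` J"
    then obtain i where i: "i \<in> J" "f = F i" by auto
    have "0 = (\<Sum>x\<in>F ` J. (\<lambda>p. c x * x p)) (P i)" using c by simp
    also have "\<dots> = (\<Sum>j\<in>J. c (F j) * F j (P i))"
      by (simp add: sum_fun_eval sum.reindex[OF inj])
    also have "\<dots> = (\<Sum>j\<in>J. if j = i then c (F i) * F i (P i) else 0)"
      using P[OF i(1)] by (intro sum.cong) auto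
    also have "\<dots> = c (F i) * F i (P i)" using i J by simp
    finally show "c f = 0" using P[OF i(1) i(1)] i(2) by simp
  qed (use J in simp)
  have "card (F ` J) \<le> card B"
    using independent_span_bound[OF finB ind] F B(3) by auto
  thus ?thesis using card_image[OF inj] B(4) unfolding lap_mult_def by simp
qed

section \<open>Lattice triangles in integer coordinates\<close>

text \<open>The real coordinates in the basis 1, \<omega> of the plane.\<close>

definition coord_x :: "complex \<Rightarrow> real" where "coord_x v = Re v - Im v / sqrt 3"
definition coord_y :: "complex \<Rightarrow> real" where "coord_y v = 2 * Im v / sqrt 3"

lemma omega_eq: "\<omega> = Complex (1/2) (sqrt 3 / 2)"
  by (simp add: \<omega>_def cis.ctr cos_60 sin_60)

lemma Re_omega [simp]: "Re \<omega> = 1/2" and Im_omega [simp]: "Im \<omega> = sqrt 3 / 2"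
  by (simp_all add: omega_eq)

lemma omega_square: "\<omega> * \<omega> = \<omega> - 1"
  by (rule complex_eqI) simp_all

lemma omega_power_4: "\<omega> ^ 4 = - \<omega>"
proof -
  have "\<omega> ^ 4 = (\<omega> * \<omega>) * (\<omega> * \<omega>)" by (simp add: power4_eq_xxxx mult.assoc)
  also have "\<dots> = (\<omega> - 1) * (\<omega> - 1)" by (simp add: omega_square)
  also have "\<dots> = \<omega> * \<omega> - 2 * \<omega> + 1" by (simp add: algebra_simps)
  finally show ?thesis by (simp add: omega_square)
qed

lemma linear_coord [intro]: "linear coord_x" "linear coord_y"
  by (auto intro!: linearI simp: coord_x_def coord_y_def add_divide_distrib algebra_simps)

lemma coord_latp [simp]: "coord_x (latp a b) = of_int a" "coord_y (latp a b) = of_int b"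
  by (simp_all add: coord_x_def coord_y_def latp_def)

lemma coord_omega_mult: "coord_x (\<omega> * v) = - coord_y v" "coord_y (\<omega> * v) = coord_x v + coord_y v"
  by (simp_all add: coord_x_def coord_y_def field_simps)

lemma coord_eqI: "coord_x v = coord_x w \<Longrightarrow> coord_y v = coord_y w \<Longrightarrow> v = w"
  by (simp add: coord_x_def coord_y_def complex_eq_iff)

lemma latp_eq_iff [simp]: "latp a b = latp a' b' \<longleftrightarrow> a = a' \<and> b = b'"
proof
  assume "latp a b = latp a' b'"
  hence "coord_x (latp a b) = coord_x (latp a' b')" "coord_y (latp a b) = coord_y (latp a' b')"
    by simp_all
  thus "a = a' \<and> b = b'" by simp
qed simp

lemma gc_z_latp: "gc_z k l = latp (int k) (int l)"
  by (simp add: gc_z_def latp_def)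

lemma omega_latp: "\<omega> * latp a b = latp (- b) (a + b)"
  by (rule coord_eqI) (simp_all add: coord_omega_mult)

lemma gc_rot_latp: "gc_rot (gc_z k l) (latp a b) = latp (b - int l) (int k + int l - a - b)"
proof -
  have "gc_rot (gc_z k l) (latp a b) = - (\<omega> * latp a b) + \<omega> * latp (int k) (int l)"
    by (simp add: gc_rot_def omega_power_4 gc_z_latp)
  thus ?thesis unfolding omega_latp by (simp add: latp_def algebra_simps)
qed

lemma gc_refl_latp:
  "gc_refl (gc_z k l) (latp a b) = latp (int k - int l - a) (int k + 2 * int l - b)"
proof -
  have "gc_refl (gc_z k l) (latp a b) = latp (int k) (int l) + \<omega> * latp (int k) (int l) - latp a b"
    by (simp add: gc_refl_def gc_z_latp algebra_simps)
  thus ?thesis unfolding omega_latp by (simp add: latp_def algebra_simps)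
qed

text \<open>A unit triangle is encoded by the lattice coordinates of three times its barycenter. They are
  1 modulo 3 for upward triangles and 2 modulo 3 for downward ones.\<close>
definition keys :: "(int \<times> int) set" where
  "keys = {(A, B). A mod 3 = B mod 3 \<and> A mod 3 \<noteq> 0}"

definition tri :: "int \<times> int \<Rightarrow> complex set" where
  "tri m = (let a = fst m div 3; b = snd m div 3 in
     if fst m mod 3 = 1 then {latp a b, latp (a+1) b, latp a (b+1)}
     else {latp (a+1) b, latp a (b+1), latp (a+1) (b+1)})"

definition key :: "complex set \<Rightarrow> int \<times> int" where
  "key = inv_into keys tri"

lemma keys_cases [consumes 1, case_names up down]:
  assumes "m \<in> keys"
  obtains a b where "m = (3 * a + 1, 3 * b + 1)" | a b where "m = (3 * a + 2, 3 * b + 2)"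
proof -
  obtain A B where m: "m = (A, B)" by (cases m)
  have AB: "A mod 3 = B mod 3" "A mod 3 \<noteq> 0" using assms by (auto simp: keys_def m)
  have "A = 3 * (A div 3) + A mod 3" "B = 3 * (B div 3) + B mod 3" by simp_all
  moreover have "A mod 3 = 1 \<or> A mod 3 = 2" using AB(2) by presburger
  ultimately show ?thesis using that[of "A div 3" "B div 3"] AB(1) m by metis
qed

lemma up_in_keys [simp]: "(3 * a + 1, 3 * b + 1) \<in> keys"
  and down_in_keys [simp]: "(3 * a + 2, 3 * b + 2) \<in> keys"
  by (auto simp: keys_def; presburger)+

lemma tri_up [simp]: "tri (3 * a + 1, 3 * b + 1) = {latp a b, latp (a+1) b, latp a (b+1)}"
proof -
  have "(3 * a + 1) div 3 = a" "(3 * b + 1) div 3 = b" "(3 * a + 1) mod 3 = 1" by presburger+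
  thus ?thesis by (simp add: tri_def)
qed

lemma tri_down [simp]:
  "tri (3 * a + 2, 3 * b + 2) = {latp (a+1) b, latp a (b+1), latp (a+1) (b+1)}"
proof -
  have "(3 * a + 2) div 3 = a" "(3 * b + 2) div 3 = b" "(3 * a + 2) mod 3 = 2" by presburger+
  thus ?thesis by (simp add: tri_def)
qed

lemma tri_latp: "m \<in> keys \<Longrightarrow> p \<in> tri m \<Longrightarrow> \<exists>a b. p = latp a b"
  by (erule keys_cases) auto

lemma unit_tris_eq: "unit_tris = tri ` keys"
proof
  show "tri ` keys \<subseteq> unit_tris"
  proof
    fix t assume "t \<in> tri ` keys"
    then obtain m where "m \<in> keys" "t = tri m" by auto
    thus "t \<in> unit_tris" by (cases rule: keys_cases) (auto simp: unit_tris_def)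
  qed
  show "unit_tris \<subseteq> tri ` keys"
    unfolding unit_tris_def
    by (auto simp flip: tri_up tri_down)
qed

lemma inj_on_tri: "inj_on tri keys"
proof (rule inj_onI)
  fix m m' assume "m \<in> keys" "m' \<in> keys" and eq: "tri m = tri m'"
  \<comment> \<open>The key is recovered as the sum of the corners, which is three times the
    barycenter.\<close>
  have sum: "(\<Sum>p\<in>tri n. coord_x p) = of_int (fst n)" "(\<Sum>p\<in>tri n. coord_y p) = of_int (snd n)"
    if "n \<in> keys" for n
    using that by (cases rule: keys_cases; simp)+
  show "m = m'"
    using sum[OF \<open>m \<in> keys\<close>] sum[OF \<open>m' \<in> keys\<close>] eq by (simp add: prod_eq_iff)
qed

lemma key_tri [simp]: "m \<in> keys \<Longrightarrow> key (tri m) = m"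
  by (simp add: key_def inv_into_f_f[OF inj_on_tri])

text \<open>The steps of the tripled barycenter across the three sides; \<open>s\<close> is the
  orientation of the triangle.\<close>

definition nb :: "int \<times> int \<Rightarrow> (int \<times> int) set" where
  "nb m = (let A = fst m; B = snd m; s = (if A mod 3 = 1 then 1 else -1) in
     {(A + s, B + s), (A - 2 * s, B + s), (A + s, B - 2 * s)})"

lemma nb_up: "nb (3 * a + 1, 3 * b + 1) =
    {(3 * a + 2, 3 * b + 2), (3 * (a - 1) + 2, 3 * b + 2), (3 * a + 2, 3 * (b - 1) + 2)}"
proof -
  have "(3 * a + 1) mod 3 = 1" by presburger
  thus ?thesis by (simp add: nb_def Let_def ac_simps)
qed

lemma nb_down: "nb (3 * a + 2, 3 * b + 2) =
    {(3 * a + 1, 3 * b + 1), (3 * (a + 1) + 1, 3 * b + 1), (3 * a + 1, 3 * (b + 1) + 1)}"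
proof -
  have "(3 * a + 2) mod 3 = 2" by presburger
  thus ?thesis by (simp add: nb_def Let_def ac_simps)
qed

lemma nb_in_keys:
  assumes "m \<in> keys" "m' \<in> nb m"
  shows "m' \<in> keys"
  using assms(1)
proof (cases rule: keys_cases)
  case (up a b)
  show ?thesis using assms(2) down_in_keys unfolding up nb_up by blast
next
  case (down a b)
  show ?thesis using assms(2) up_in_keys unfolding down nb_down by blast
qed

lemma card_inter_le_1:
  assumes "\<And>p q. p \<in> S \<Longrightarrow> p \<in> T \<Longrightarrow> q \<in> S \<Longrightarrow> q \<in> T \<Longrightarrow> p = q"
  shows "card (S \<inter> T) \<noteq> 2"
proof
  assume "card (S \<inter> T) = 2"
  then obtain p q where "S \<inter> T = {p, q}" "p \<noteq> q" by (meson card_2_iff)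
  thus False using assms[of p q] by blast
qed

lemma card_up_inter_down:
  "card ({latp a b, latp (a+1) b, latp a (b+1)} \<inter>
         {latp (a'+1) b', latp a' (b'+1), latp (a'+1) (b'+1)}) = 2 \<longleftrightarrow>
   a' = a \<and> b' = b \<or> a' = a - 1 \<and> b' = b \<or> a' = a \<and> b' = b - 1"
  (is "card (?U \<inter> ?V) = 2 \<longleftrightarrow> ?R")
proof
  show "card (?U \<inter> ?V) = 2" if ?R
    using that by (auto simp: Int_insert_left)
  show ?R if "card (?U \<inter> ?V) = 2"
  proof (rule ccontr)
    assume "\<not> ?R"
    hence "card (?U \<inter> ?V) \<noteq> 2" by (intro card_inter_le_1) auto
    thus False using that by simp
  qed
qed

lemma tri_adj_iff:
  assumes "m \<in> keys" "m' \<in> keys"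
  shows "tri_adj (tri m) (tri m') \<longleftrightarrow> m' \<in> nb m"
proof -
  have u: "tri m \<in> unit_tris" "tri m' \<in> unit_tris" using assms by (auto simp: unit_tris_eq)
  have same: "card (tri m \<inter> tri m') \<noteq> 2" if "c = 1 \<or> c = 2"
    "m = (3 * a + c, 3 * b + c)" "m' = (3 * a' + c, 3 * b' + c)" for a b a' b' c
  proof (cases "a = a' \<and> b = b'")
    case True
    thus ?thesis using that by auto
  next
    case False
    thus ?thesis using that by (intro card_inter_le_1) auto
  qed
  have "card (tri m \<inter> tri m') = 2 \<longleftrightarrow> m' \<in> nb m"
    using assms(1)
  proof (cases rule: keys_cases)
    case m: (up a b)
    show ?thesis using assms(2)
    proof (cases rule: keys_cases)
      case m': (up a' b')
      have "m' \<notin> nb m" unfolding m m' nb_up by (simp; presburger)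
      thus ?thesis using same[of 1] m m' by blast
    next
      case m': (down a' b')
      show ?thesis unfolding m m' tri_up tri_down nb_up card_up_inter_down by auto
    qed
  next
    case m: (down a b)
    show ?thesis using assms(2)
    proof (cases rule: keys_cases)
      case m': (up a' b')
      show ?thesis
        unfolding m m' tri_up tri_down nb_down Int_commute[of "{latp (a+1) b, _, _}"] card_up_inter_down
        by auto
    next
      case m': (down a' b')
      have "m' \<notin> nb m" unfolding m m' nb_down by (simp; presburger)
      thus ?thesis using same[of 2] m m' by blast
    qed
  qed
  thus ?thesis using u by (simp add: tri_adj_def)
qed

text \<open>\<open>rotK\<close> and \<open>reflK\<close> are \<open>gc_rot\<close> and
  \<open>gc_refl\<close> on tripled barycenters: same linear part, tripled translation.\<close>

definition rotK :: "int \<Rightarrow> int \<Rightarrow> int \<times> int \<Rightarrow> int \<times> int" where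
  "rotK k l m = (snd m - 3 * l, 3 * k + 3 * l - fst m - snd m)"

definition reflK :: "int \<Rightarrow> int \<Rightarrow> int \<times> int \<Rightarrow> int \<times> int" where
  "reflK k l m = (3 * k - 3 * l - fst m, 3 * k + 6 * l - snd m)"

lemma rotK_up: "rotK k l (3 * a + 1, 3 * b + 1) = (3 * (b - l) + 1, 3 * (k + l - a - b - 1) + 1)"
  and rotK_down: "rotK k l (3 * a + 2, 3 * b + 2) = (3 * (b - l) + 2, 3 * (k + l - a - b - 2) + 2)"
  and reflK_up: "reflK k l (3 * a + 1, 3 * b + 1) = (3 * (k - l - a - 1) + 2, 3 * (k + 2 * l - b - 1) + 2)"
  and reflK_down: "reflK k l (3 * a + 2, 3 * b + 2) = (3 * (k - l - a - 1) + 1, 3 * (k + 2 * l - b - 1) + 1)"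
  by (simp_all add: rotK_def reflK_def)

lemma rotK_in_keys [simp, intro]: "m \<in> keys \<Longrightarrow> rotK k l m \<in> keys"
  by (erule keys_cases) (simp_all only: rotK_up rotK_down up_in_keys down_in_keys)

lemma reflK_in_keys [simp, intro]: "m \<in> keys \<Longrightarrow> reflK k l m \<in> keys"
  by (erule keys_cases) (simp_all only: reflK_up reflK_down up_in_keys down_in_keys)

lemma gc_rot_tri: "m \<in> keys \<Longrightarrow> gc_rot (gc_z k l) ` tri m = tri (rotK (int k) (int l) m)"
  by (erule keys_cases)
     (simp_all only: rotK_up rotK_down tri_up tri_down image_insert image_empty gc_rot_latp, auto)

lemma gc_refl_tri: "m \<in> keys \<Longrightarrow> gc_refl (gc_z k l) ` tri m = tri (reflK (int k) (int l) m)"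
  by (erule keys_cases)
     (simp_all only: reflK_up reflK_down tri_up tri_down image_insert image_empty gc_refl_latp, auto)

lemma rotK_cubed: "rotK k l (rotK k l (rotK k l m)) = m"
  by (simp add: rotK_def prod_eq_iff)

lemma reflK_reflK [simp]: "reflK k l (reflK k l m) = m"
  by (simp add: reflK_def prod_eq_iff)

lemma nb_rotK: "m \<in> keys \<Longrightarrow> nb (rotK k l m) = rotK k l ` nb m"
  by (erule keys_cases)
     (simp_all only: rotK_up rotK_down nb_up nb_down image_insert image_empty, auto)

lemma nb_reflK: "m \<in> keys \<Longrightarrow> nb (reflK k l m) = reflK k l ` nb m"
  by (erule keys_cases)
     (simp_all only: reflK_up reflK_down nb_up nb_down image_insert image_empty, auto)


section \<open>The unit triangles of the fundamental triangle\<close>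

lemma linear_le_on_hull:
  fixes L :: "complex \<Rightarrow> real"
  assumes L: "linear L" and v: "v \<in> convex hull S" and S: "\<And>p. p \<in> S \<Longrightarrow> L p \<le> c"
  shows "L v \<le> c"
proof -
  have "convex {v. L v \<le> c}"
  proof (rule convexI)
    fix x y :: complex and u w :: real
    assume *: "x \<in> {v. L v \<le> c}" "y \<in> {v. L v \<le> c}" "0 \<le> u" "0 \<le> w" "u + w = 1"
    have "L (u *\<^sub>R x + w *\<^sub>R y) = u * L x + w * L y"
      by (simp add: linear_add[OF L] linear_scale[OF L])
    also have "\<dots> \<le> u * c + w * c" using * by (intro add_mono mult_left_mono) auto
    also have "\<dots> = c" using *(5) by (simp flip: distrib_right)
    finally show "u *\<^sub>R x + w *\<^sub>R y \<in> {v. L v \<le> c}" by simp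
  qed
  thus ?thesis using hull_minimal[of S "{v. L v \<le> c}" convex] S v by auto
qed

lemma not_collinear_complex:
  assumes "Im (cnj (b - a) * (c - a)) \<noteq> 0"
  shows "\<not> collinear {a, b, c :: complex}"
proof
  assume "collinear {a, b, c}"
  hence "collinear {b, a, c}" by (simp add: insert_commute)
  hence "collinear {0, b - a, c - a}" by (simp add: collinear_3)
  then consider "b - a = 0" | "c - a = 0" | r where "c - a = r *\<^sub>R (b - a)"
    by (auto simp: collinear_lemma)
  thus False
  proof cases
    case 3
    have "cnj w * (r *\<^sub>R w) = of_real (r * (cmod w)\<^sup>2)" for w
      using complex_norm_square[of w] by (simp add: scaleR_conv_of_real mult_ac)
    hence "cnj (b - a) * (c - a) = of_real (r * (cmod (b - a))\<^sup>2)" unfolding 3 .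
    thus False using assms by (simp only: Im_complex_of_real)
  qed (use assms in auto)
qed

lemma interior_triangle:
  assumes "Im (cnj (b - a) * (c - a)) \<noteq> 0"
  shows "interior (convex hull {a, b, c :: complex}) =
     {v. \<exists>x y z. 0 < x \<and> 0 < y \<and> 0 < z \<and> x + y + z = 1 \<and> x *\<^sub>R a + y *\<^sub>R b + z *\<^sub>R c = v}"
  using interior_convex_hull_3_minimal[OF not_collinear_complex[OF assms]] by simp

definition sq_norm :: "nat \<Rightarrow> nat \<Rightarrow> int" where
  "sq_norm k l = int (k * k + k * l + l * l)"

text \<open>The barycenter of the triangle with key m lies in the closed triangle T.\<close>
definition reg :: "nat \<Rightarrow> nat \<Rightarrow> int \<times> int \<Rightarrow> bool" where
  "reg k l m \<longleftrightarrow> 0 \<le> int k * snd m - int l * fst m \<and> 0 \<le> int (k + l) * fst m + int l * snd m \<and>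
     int k * fst m + int (k + l) * snd m \<le> 3 * sq_norm k l"

lemma interior_T:
  assumes "k > 0"
  shows "interior (convex hull {0, gc_z k l, \<omega> * gc_z k l}) =
     {v. \<exists>x y z. 0 < x \<and> 0 < y \<and> 0 < z \<and> x + y + z = 1 \<and>
        x *\<^sub>R 0 + y *\<^sub>R gc_z k l + z *\<^sub>R (\<omega> * gc_z k l) = v}"
proof (rule interior_triangle)
  have Im_omega_mult: "Im (\<omega> * of_real x) = sqrt 3 / 2 * x" for x by simp
  have "cnj (gc_z k l) * (\<omega> * gc_z k l) = \<omega> * of_real ((cmod (gc_z k l))\<^sup>2)"
    using complex_norm_square[of "gc_z k l"] by (simp add: mult_ac)
  hence eq: "Im (cnj (gc_z k l) * (\<omega> * gc_z k l)) = sqrt 3 / 2 * (cmod (gc_z k l))\<^sup>2"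
    using Im_omega_mult by (simp only:)
  have "gc_z k l \<noteq> 0"
    using assms latp_eq_iff[of "int k" "int l" 0 0] by (simp add: gc_z_latp latp_def)
  thus "Im (cnj (gc_z k l - 0) * (\<omega> * gc_z k l - 0)) \<noteq> 0" unfolding diff_0_right eq by simp
qed

text \<open>Up to the factor \<open>n\<close>, the squared side length of T, the distances from
  equality are the barycentric coordinates, which are positive in the interior.\<close>

lemma interior_T_coords:
  assumes k: "k > 0" and v: "v \<in> interior (convex hull {0, gc_z k l, \<omega> * gc_z k l})"
  shows "0 < real k * coord_y v - real l * coord_x v"
    "0 < real (k + l) * coord_x v + real l * coord_y v"
    "real k * coord_x v + real (k + l) * coord_y v < real (k * k + k * l + l * l)"
proof -
  obtain x y z where xyz: "0 < x" "0 < y" "0 < z" "x + y + z = 1"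
    "v = y *\<^sub>R gc_z k l + z *\<^sub>R (\<omega> * gc_z k l)"
    using v unfolding interior_T[OF k] by auto
  have X: "coord_x v = y * real k - z * real l" and Y: "coord_y v = y * real l + z * (real k + real l)"
    unfolding xyz(5) gc_z_latp omega_latp linear_add[OF linear_coord(1)] linear_add[OF linear_coord(2)]
      linear_scale[OF linear_coord(1)] linear_scale[OF linear_coord(2)] by simp_all
  define n where "n = real (k * k + k * l + l * l)"
  have n: "n > 0" using k by (simp add: n_def add_pos_nonneg)
  have "real k * coord_y v - real l * coord_x v = z * n"
    "real (k + l) * coord_x v + real l * coord_y v = y * n"
    "real k * coord_x v + real (k + l) * coord_y v = n - x * n"
  proof -
    have x: "x = 1 - y - z" using xyz(4) by simp
    show "real k * coord_y v - real l * coord_x v = z * n"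
      "real (k + l) * coord_x v + real l * coord_y v = y * n"
      "real k * coord_x v + real (k + l) * coord_y v = n - x * n"
      unfolding X Y n_def x by (simp_all add: algebra_simps)
  qed
  thus "0 < real k * coord_y v - real l * coord_x v"
    "0 < real (k + l) * coord_x v + real l * coord_y v"
    "real k * coord_x v + real (k + l) * coord_y v < real (k * k + k * l + l * l)"
    using n xyz(1-3) unfolding n_def[symmetric] by simp_all
qed

text \<open>The barycenter is interior to its unit triangle and lies in T, which is contained in the
  closure of its own interior. Hence the two interiors meet.\<close>

lemma tri_in_region_if_reg:
  assumes k: "k > 0" and m: "m \<in> keys" and r: "reg k l m"
  shows "tri m \<in> tri_region (gc_z k l)"
proof -
  let ?T = "convex hull {0, gc_z k l, \<omega> * gc_z k l}"
  define n where "n = real (k * k + k * l + l * l)"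
  have n: "n > 0" using k by (simp add: n_def add_pos_nonneg)
  define A B where "A = real_of_int (fst m)" and "B = real_of_int (snd m)"
  define c where "c = (1/3) *\<^sub>R latp (fst m) (snd m)"
  have c: "coord_x c = A / 3" "coord_y c = B / 3"
    by (simp_all add: c_def A_def B_def linear_scale[OF linear_coord(1)] linear_scale[OF linear_coord(2)])
  have "real_of_int 0 \<le> real_of_int (int k * snd m - int l * fst m)"
    "real_of_int 0 \<le> real_of_int (int (k + l) * fst m + int l * snd m)"
    "real_of_int (int k * fst m + int (k + l) * snd m) \<le> real_of_int (3 * sq_norm k l)"
    using r unfolding reg_def of_int_le_iff by simp_all
  hence ineq: "0 \<le> real k * B - real l * A" "0 \<le> real (k + l) * A + real l * B"
    "real k * A + real (k + l) * B \<le> 3 * n"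
    by (simp_all add: A_def B_def n_def sq_norm_def)
  have "c \<in> ?T"
  proof -
    define y z where "y = (real (k + l) * A + real l * B) / (3 * n)"
      and "z = (real k * B - real l * A) / (3 * n)"
    have yz: "0 \<le> y" "0 \<le> z" using ineq n by (simp_all add: y_def z_def)
    have "y + z = (real k * A + real (k + l) * B) / (3 * n)"
      by (simp add: y_def z_def algebra_simps flip: add_divide_distrib)
    hence "y + z \<le> 1" using ineq n by simp
    moreover have "c = (1 - y - z) *\<^sub>R 0 + y *\<^sub>R gc_z k l + z *\<^sub>R (\<omega> * gc_z k l)"
    proof (rule coord_eqI)
      have "n \<noteq> 0" using n by simp
      have "y * real k - z * real l = (A * n) / (3 * n)" "y * real l + z * (real k + real l) = (B * n) / (3 * n)"
        unfolding y_def z_def n_def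
        by (simp_all add: algebra_simps flip: add_divide_distrib diff_divide_distrib)
      thus "coord_x c = coord_x ((1 - y - z) *\<^sub>R 0 + y *\<^sub>R gc_z k l + z *\<^sub>R (\<omega> * gc_z k l))"
        "coord_y c = coord_y ((1 - y - z) *\<^sub>R 0 + y *\<^sub>R gc_z k l + z *\<^sub>R (\<omega> * gc_z k l))"
        unfolding c gc_z_latp omega_latp linear_add[OF linear_coord(1)] linear_add[OF linear_coord(2)]
          linear_scale[OF linear_coord(1)] linear_scale[OF linear_coord(2)]
        using \<open>n \<noteq> 0\<close> by (simp_all add: linear_0[OF linear_coord(1)] linear_0[OF linear_coord(2)])
    qed
    ultimately show ?thesis using yz unfolding convex_hull_3
      by (intro CollectI exI[of _ "1 - y - z"] exI[of _ y] exI[of _ z]) auto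
  qed
  moreover have "?T \<subseteq> closure (interior ?T)"
  proof -
    have "(1/3) *\<^sub>R 0 + (1/3) *\<^sub>R gc_z k l + (1/3) *\<^sub>R (\<omega> * gc_z k l) \<in> interior ?T"
      unfolding interior_T[OF k] by (intro CollectI exI[of _ "1/3"]) auto
    hence "closure (interior ?T) = closure ?T" by (intro convex_closure_interior) auto
    thus ?thesis using closure_subset by blast
  qed
  moreover have "c \<in> interior (convex hull (tri m))"
    using m
  proof (cases rule: keys_cases)
    case (up a b)
    have "(1/3) *\<^sub>R latp a b + (1/3) *\<^sub>R latp (a+1) b + (1/3) *\<^sub>R latp a (b+1) = c"
      by (rule coord_eqI) (simp_all add: c up A_def B_def linear_add[OF linear_coord(1)]
         linear_add[OF linear_coord(2)] linear_scale[OF linear_coord(1)] linear_scale[OF linear_coord(2)])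
    moreover have "Im (cnj (latp (a+1) b - latp a b) * (latp a (b+1) - latp a b)) \<noteq> 0"
      by (simp add: latp_def algebra_simps)
    ultimately show ?thesis
      unfolding up tri_up by (subst interior_triangle) (auto intro!: exI[of _ "1/3"])
  next
    case (down a b)
    have "(1/3) *\<^sub>R latp (a+1) b + (1/3) *\<^sub>R latp a (b+1) + (1/3) *\<^sub>R latp (a+1) (b+1) = c"
      by (rule coord_eqI) (simp_all add: c down A_def B_def linear_add[OF linear_coord(1)]
         linear_add[OF linear_coord(2)] linear_scale[OF linear_coord(1)] linear_scale[OF linear_coord(2)])
    moreover have "Im (cnj (latp a (b+1) - latp (a+1) b) * (latp (a+1) (b+1) - latp (a+1) b)) \<noteq> 0"
      by (simp add: latp_def algebra_simps)
    ultimately show ?thesis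
      unfolding down tri_down by (subst interior_triangle) (auto intro!: exI[of _ "1/3"])
  qed
  ultimately have "interior (convex hull (tri m)) \<inter> interior ?T \<noteq> {}"
    using open_Int_closure_eq_empty[OF open_interior, of "convex hull (tri m)" "interior ?T"] by blast
  moreover have "interior (convex hull (tri m)) \<subseteq> convex hull (tri m)" by (rule interior_subset)
  ultimately show ?thesis using m unfolding tri_region_def unit_tris_eq by blast
qed

lemma tri_region_vertices:
  fixes L :: "complex \<Rightarrow> real"
  assumes "tri m \<in> tri_region (gc_z k l)" "linear L"
    "\<And>v. v \<in> interior (convex hull {0, gc_z k l, \<omega> * gc_z k l}) \<Longrightarrow> L v > c"
  obtains p where "p \<in> tri m" "L p > c"
proof -
  obtain v where v: "v \<in> convex hull (tri m)" "v \<in> interior (convex hull {0, gc_z k l, \<omega> * gc_z k l})"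
    using assms(1) unfolding tri_region_def by blast
  have "\<not> (\<forall>p\<in>tri m. L p \<le> c)"
    using linear_le_on_hull[OF assms(2) v(1), of c] assms(3)[OF v(2)] by force
  thus ?thesis using that by force
qed

lemma reg_simps:
  assumes "k > 0"
  shows "reg k 0 (A, B) \<longleftrightarrow> 0 \<le> A \<and> 0 \<le> B \<and> A + B \<le> 3 * int k"
    "reg k k (A, B) \<longleftrightarrow> A \<le> B \<and> 0 \<le> 2 * A + B \<and> A + 2 * B \<le> 9 * int k"
proof -
  have le: "int k * x \<le> int k * y \<longleftrightarrow> x \<le> y" for x y using assms by simp
  show "reg k 0 (A, B) \<longleftrightarrow> 0 \<le> A \<and> 0 \<le> B \<and> A + B \<le> 3 * int k"
    using le[of 0 A] le[of 0 B] le[of "A + B" "3 * int k"]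
    by (auto simp: reg_def sq_norm_def algebra_simps)
  show "reg k k (A, B) \<longleftrightarrow> A \<le> B \<and> 0 \<le> 2 * A + B \<and> A + 2 * B \<le> 9 * int k"
    using le[of A B] le[of 0 "2 * A + B"] le[of "A + 2 * B" "9 * int k"]
    by (auto simp: reg_def sq_norm_def algebra_simps)
qed

text \<open>For each side of T some corner of the triangle lies strictly on the inner side. Divided
  by k, the linear form of the side is integral on the lattice. Its values at the corners are two
  consecutive integers, one of them repeated, if l = 0, and three consecutive integers if l = k. In
  both cases one corner strictly inside keeps the mean from lying outside.\<close>

lemma reg_if_tri_in_region:
  assumes k: "k > 0" and l: "l = 0 \<or> l = k" and m: "m \<in> keys"
    and T: "tri m \<in> tri_region (gc_z k l)"
  shows "reg k l m"
proof -
  have kr: "real k * x > 0 \<longleftrightarrow> x > 0" "real k * x < real k * y \<longleftrightarrow> x < y" for x y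
    using k by (simp_all add: zero_less_mult_iff)
  note L = linear_add[OF linear_coord(1)] linear_add[OF linear_coord(2)]
    linear_scale[OF linear_coord(1)] linear_scale[OF linear_coord(2)]
  show ?thesis
  proof (cases "l = 0")
    case l0: True
    have c: "coord_x v > 0" "coord_y v > 0" "- coord_x v - coord_y v > - real k"
      if "v \<in> interior (convex hull {0, gc_z k l, \<omega> * gc_z k l})" for v
      using interior_T_coords[OF k that] kr[of "coord_x v"] kr[of "coord_y v"]
        kr(2)[of "coord_x v + coord_y v" k] by (simp_all add: l0 algebra_simps)
    have lin: "linear (\<lambda>v. - coord_x v - coord_y v)"
      by (rule linearI) (simp_all add: L algebra_simps)
    obtain p1 p2 p3 where p: "p1 \<in> tri m" "coord_x p1 > 0" "p2 \<in> tri m" "coord_y p2 > 0"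
      "p3 \<in> tri m" "- coord_x p3 - coord_y p3 > - real k"
      using tri_region_vertices[OF T linear_coord(1) c(1)] tri_region_vertices[OF T linear_coord(2) c(2)]
        tri_region_vertices[OF T lin c(3)] by metis
    obtain x1 y1 x2 y2 x3 y3 where xy: "p1 = latp x1 y1" "p2 = latp x2 y2" "p3 = latp x3 y3"
      using tri_latp[OF m] p(1,3,5) by metis
    have ineq: "x1 > 0" "y2 > 0" "x3 + y3 < int k" using p(2,4,6) unfolding xy coord_latp by linarith+
    show ?thesis using m
      by (cases rule: keys_cases)
        (use p(1,3,5) ineq in \<open>auto simp: xy l0 reg_simps[OF k]\<close>)
  next
    case False
    hence lk: "l = k" using l by simp
    have c: "coord_y v - coord_x v > 0" "2 * coord_x v + coord_y v > 0" "- coord_x v - 2 * coord_y v > - 3 * real k"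
      if "v \<in> interior (convex hull {0, gc_z k l, \<omega> * gc_z k l})" for v
      using interior_T_coords[OF k that] kr[of "coord_y v - coord_x v"] kr[of "2 * coord_x v + coord_y v"]
        kr(2)[of "coord_x v + 2 * coord_y v" "3 * k"] by (simp_all add: lk algebra_simps)
    have lin: "linear (\<lambda>v. coord_y v - coord_x v)" "linear (\<lambda>v. 2 * coord_x v + coord_y v)"
      "linear (\<lambda>v. - coord_x v - 2 * coord_y v)"
      by (rule linearI; simp add: L algebra_simps)+
    obtain p1 p2 p3 where p: "p1 \<in> tri m" "coord_y p1 - coord_x p1 > 0"
      "p2 \<in> tri m" "2 * coord_x p2 + coord_y p2 > 0"
      "p3 \<in> tri m" "- coord_x p3 - 2 * coord_y p3 > - 3 * real k"
      using tri_region_vertices[OF T lin(1) c(1)] tri_region_vertices[OF T lin(2) c(2)]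
        tri_region_vertices[OF T lin(3) c(3)] by metis
    obtain x1 y1 x2 y2 x3 y3 where xy: "p1 = latp x1 y1" "p2 = latp x2 y2" "p3 = latp x3 y3"
      using tri_latp[OF m] p(1,3,5) by metis
    have ineq: "y1 - x1 > 0" "2 * x2 + y2 > 0" "x3 + 2 * y3 < 3 * int k"
      using p(2,4,6) unfolding xy coord_latp by linarith+
    show ?thesis using m
      by (cases rule: keys_cases)
        (use p(1,3,5) ineq in \<open>auto simp: xy lk reg_simps[OF k]\<close>)
  qed
qed


lemma tri_region_iff:
  assumes "k > 0" "l = 0 \<or> l = k" "m \<in> keys"
  shows "tri m \<in> tri_region (gc_z k l) \<longleftrightarrow> reg k l m"
  using assms reg_if_tri_in_region tri_in_region_if_reg by blast

lemma finite_reg: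
  assumes k: "k > 0" and l: "l = 0 \<or> l = k"
  shows "finite {m. reg k l m}"
proof (rule finite_subset)
  show "{m. reg k l m} \<subseteq> {- 9 * int k..9 * int k} \<times> {- 9 * int k..9 * int k}"
    using l by (auto simp: reg_simps[OF k])
qed auto

section \<open>Overlaps between T and the triangles attached to its sides\<close>

locale region =
  fixes k l :: nat
  assumes k_pos: "k > 0" and kl: "l = 0 \<or> l = k"
begin

abbreviation "rt \<equiv> rotK (int k) (int l)"
abbreviation "rf \<equiv> reflK (int k) (int l)"
abbreviation "rg \<equiv> reg k l"

lemma rg_rt: "rg (rt m) \<longleftrightarrow> rg m"
  using kl by (cases m) (auto simp: rotK_def reg_simps[OF k_pos])

text \<open>The triangles attached to two different sides of T meet only in a corner of T.\<close>

lemma rg_two_sides: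
  assumes "m \<in> keys" "rg (rf m)" "rg (rf (rt m))"
  shows "rg m"
  using assms(1)
proof (cases rule: keys_cases)
  case (up a b)
  show ?thesis using kl assms(2,3) unfolding up
    by (auto simp: rotK_def reflK_def reg_simps[OF k_pos])
next
  case (down a b)
  show ?thesis using kl assms(2,3) unfolding down
    by (auto simp: rotK_def reflK_def reg_simps[OF k_pos])
qed

text \<open>Here the barycenter of m lies on the common side of T and the attached triangle, which
  occurs only for l = k. The triangles next to m then stay within the union of the two.\<close>

lemma rg_nb_overlap:
  assumes "m \<in> keys" "rg m" "rg (rf m)" "m' \<in> nb m"
  shows "rg m' \<or> rg (rf m')"
  using assms(1)
proof (cases rule: keys_cases)
  case (up a b)
  show ?thesis using kl assms(2-4) unfolding up nb_up
    by (auto simp: rotK_def reflK_def reg_simps[OF k_pos]; presburger)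
next
  case (down a b)
  show ?thesis using kl assms(2-4) unfolding down nb_down
    by (auto simp: rotK_def reflK_def reg_simps[OF k_pos]; presburger)
qed

lemma rg_nb:
  assumes "m \<in> keys" "rg m" "m' \<in> nb m"
  shows "rg m' \<or> rg (rf m') \<or> rg (rf (rt m')) \<or> rg (rf (rt (rt m')))"
  using assms(1)
proof (cases rule: keys_cases)
  case (up a b)
  show ?thesis using kl assms(2-3) unfolding up nb_up
    by (auto simp: rotK_def reflK_def reg_simps[OF k_pos]; presburger)
next
  case (down a b)
  show ?thesis using kl assms(2-3) unfolding down nb_down
    by (auto simp: rotK_def reflK_def reg_simps[OF k_pos]; presburger)
qed

end

section \<open>Vertices and edges of the Goldberg--Coxeter graph\<close>

locale gc = region +
  fixes D :: "'d set" and \<alpha> \<sigma> :: "'d \<Rightarrow> 'd"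
  assumes finite_D: "finite D"
    and \<sigma>_in: "d \<in> D \<Longrightarrow> \<sigma> d \<in> D" and \<sigma>_cubed: "d \<in> D \<Longrightarrow> \<sigma> (\<sigma> (\<sigma> d)) = d"
    and \<alpha>_in: "d \<in> D \<Longrightarrow> \<alpha> d \<in> D" and \<alpha>_\<alpha>: "d \<in> D \<Longrightarrow> \<alpha> (\<alpha> d) = d"
begin

abbreviation "B \<equiv> gc_base D k l"
abbreviation "G \<equiv> gc_gen D \<alpha> \<sigma> k l"
abbreviation "E \<equiv> gc_equiv D \<alpha> \<sigma> k l"
abbreviation "V \<equiv> gc_verts D \<alpha> \<sigma> k l"
abbreviation "adj \<equiv> gc_adj D \<alpha> \<sigma> k l"

lemma tri_region_rg [simp]: "m \<in> keys \<Longrightarrow> tri m \<in> tri_region (gc_z k l) \<longleftrightarrow> rg m"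
  using tri_region_iff[OF k_pos kl] .

lemma tri_region_cases:
  assumes "t \<in> tri_region (gc_z k l)"
  obtains m where "m \<in> keys" "t = tri m" "rg m"
  using assms tri_region_rg unfolding tri_region_def unit_tris_eq by blast

lemma base_iff: "m \<in> keys \<Longrightarrow> (d, tri m) \<in> B \<longleftrightarrow> d \<in> D \<and> rg m"
  by (simp add: gc_base_def)

lemma base_cases:
  assumes "x \<in> B"
  obtains d m where "x = (d, tri m)" "d \<in> D" "m \<in> keys" "rg m"
  using assms unfolding gc_base_def by (auto elim: tri_region_cases)

lemma gen_cases:
  assumes "(x, y) \<in> G"
  obtains d m where "d \<in> D" "m \<in> keys" "rg m" "x = (d, tri m)" "y = (\<sigma> d, tri (rt m))"
  | d m where "d \<in> D" "m \<in> keys" "rg m" "rg (rf m)" "x = (d, tri m)" "y = (\<alpha> d, tri (rf m))"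
proof -
  from assms consider
      (rot) d t where "d \<in> D" "t \<in> tri_region (gc_z k l)" "x = (d, t)" "y = (\<sigma> d, gc_rot (gc_z k l) ` t)"
    | (refl) d t where "d \<in> D" "t \<in> tri_region (gc_z k l)" "gc_refl (gc_z k l) ` t \<in> tri_region (gc_z k l)"
        "x = (d, t)" "y = (\<alpha> d, gc_refl (gc_z k l) ` t)"
    unfolding gc_gen_def by blast
  thus ?thesis
  proof cases
    case rot
    obtain m where "m \<in> keys" "t = tri m" "rg m" using tri_region_cases[OF rot(2)] .
    thus ?thesis using that(1) rot by (simp add: gc_rot_tri)
  next
    case refl
    obtain m where m: "m \<in> keys" "t = tri m" "rg m" using tri_region_cases[OF refl(2)] .
    hence "rg (rf m)" using refl(3) by (simp add: gc_refl_tri)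
    thus ?thesis using that(2) m refl by (simp add: gc_refl_tri)
  qed
qed

lemma gen_base: "(x, y) \<in> G \<Longrightarrow> x \<in> B \<and> y \<in> B"
  by (erule gen_cases) (auto simp: base_iff \<sigma>_in \<alpha>_in rg_rt)

lemma equiv_E: "equiv B E"
proof (rule equivI)
  show "E \<subseteq> B \<times> B" by (auto simp: gc_equiv_def)
  show "refl_on B E" by (auto simp: refl_on_def gc_equiv_def)
  show "sym E"
    unfolding gc_equiv_def by (rule symI) (auto intro: eqcl_sym[unfolded eqcl_def])
  show "trans E" unfolding gc_equiv_def by (rule transI) (auto intro: rtrancl_trans)
qed

lemma gen_E: "(x, y) \<in> G \<Longrightarrow> (x, y) \<in> E"
  using gen_base by (auto simp: gc_equiv_def)

lemma E_rt: "d \<in> D \<Longrightarrow> m \<in> keys \<Longrightarrow> rg m \<Longrightarrow> ((d, tri m), (\<sigma> d, tri (rt m))) \<in> E"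
  by (rule gen_E) (auto simp: gc_gen_def gc_rot_tri[symmetric])

lemma E_rf:
  "d \<in> D \<Longrightarrow> m \<in> keys \<Longrightarrow> rg m \<Longrightarrow> rg (rf m) \<Longrightarrow> ((d, tri m), (\<alpha> d, tri (rf m))) \<in> E"
  by (rule gen_E) (auto simp: gc_gen_def gc_refl_tri)

text \<open>Induction over the generated equivalence: only the two kinds of gluing have to be
  checked, and only for triangles that belong to T. It is applied to functions and to sets of
  neighbours alike.\<close>

lemma E_invariant:
  assumes rt: "\<And>d m. d \<in> D \<Longrightarrow> m \<in> keys \<Longrightarrow> rg m \<Longrightarrow> f (\<sigma> d) (rt m) = f d m"
    and rf: "\<And>d m. d \<in> D \<Longrightarrow> m \<in> keys \<Longrightarrow> rg m \<Longrightarrow> rg (rf m) \<Longrightarrow> f (\<alpha> d) (rf m) = f d m"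
    and E: "((d, tri m), (d', tri m')) \<in> E" and keys: "m \<in> keys" "m' \<in> keys"
  shows "f d m = f d' m'"
proof -
  define F where "F = (\<lambda>x. f (fst x) (key (snd x)))"
  have G: "F x = F y" if "(x, y) \<in> G" for x y
    using that by (cases rule: gen_cases) (auto simp: F_def rt rf)
  have "F (d, tri m) = F y" if "((d, tri m), y) \<in> (G \<union> G\<inverse>)\<^sup>*" for y
    using that
  proof (induction rule: rtrancl_induct)
    case (step y z)
    hence "F y = F z" using G[of y z] G[of z y] by auto
    thus ?case using step.IH by simp
  qed simp
  hence "F (d, tri m) = F (d', tri m')" using E by (auto simp: gc_equiv_def)
  thus ?thesis using keys by (simp add: F_def)
qed

section \<open>The graph as seen in the plane of one copy\<close>

definition hit :: "'d \<Rightarrow> int \<times> int \<Rightarrow> ('d \<times> complex set) set \<Rightarrow> bool" where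
  "hit d m Q \<longleftrightarrow> Q \<in> V \<and> (d, tri m) \<in> Q"

lemma hit_base: "m \<in> keys \<Longrightarrow> hit d m Q \<Longrightarrow> d \<in> D \<and> rg m"
  using in_quotient_imp_subset[OF equiv_E] base_iff unfolding hit_def gc_verts_def by blast

lemma hit_unique: "hit d m Q \<Longrightarrow> hit d m Q' \<Longrightarrow> Q = Q'"
  using quotient_disj[OF equiv_E] unfolding hit_def gc_verts_def by blast

lemma hit_E: "hit d m Q \<Longrightarrow> ((d, tri m), (d', tri m')) \<in> E \<Longrightarrow> hit d' m' Q"
  using in_quotient_imp_closed[OF equiv_E] unfolding hit_def gc_verts_def by blast

lemma hit_imp_E: "hit d m Q \<Longrightarrow> hit d' m' Q \<Longrightarrow> ((d, tri m), (d', tri m')) \<in> E"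
  using in_quotient_imp_in_rel[OF equiv_E] unfolding hit_def gc_verts_def by blast

lemma hit_exists:
  assumes "d \<in> D" "m \<in> keys" "rg m"
  obtains Q where "hit d m Q"
proof -
  have b: "(d, tri m) \<in> B" using assms base_iff by blast
  have "hit d m (E `` {(d, tri m)})"
    unfolding hit_def gc_verts_def using quotientI[OF b, of E] equiv_class_self[OF equiv_E b] by blast
  thus ?thesis by (rule that)
qed

lemma verts_cases:
  assumes "Q \<in> V"
  obtains d m where "hit d m Q" "d \<in> D" "m \<in> keys" "rg m"
proof -
  obtain x where "x \<in> B" "x \<in> Q"
    using assms equiv_class_self[OF equiv_E] unfolding gc_verts_def by (auto elim!: quotientE)
  thus ?thesis using assms that by (auto elim!: base_cases simp: hit_def)
qed

lemma verts_mem_cases: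
  assumes "Q \<in> V" "(d, t) \<in> Q"
  obtains m where "t = tri m" "m \<in> keys" "hit d m Q"
proof -
  have "(d, t) \<in> B" using assms in_quotient_imp_subset[OF equiv_E] unfolding gc_verts_def by blast
  thus ?thesis using assms that by (auto elim!: base_cases simp: hit_def)
qed

lemma finite_V: "finite V"
proof -
  have "tri_region (gc_z k l) \<subseteq> tri ` {m. rg m}" by (auto elim: tri_region_cases)
  hence "finite (tri_region (gc_z k l))"
    using finite_reg[OF k_pos kl] finite_subset by blast
  hence "finite B" unfolding gc_base_def using finite_D by simp
  thus ?thesis unfolding gc_verts_def
    using equiv_E by (auto intro: finite_quotient simp: equiv_def)
qed

lemma hit_rt: "d \<in> D \<Longrightarrow> m \<in> keys \<Longrightarrow> hit (\<sigma> d) (rt m) Q \<longleftrightarrow> hit d m Q"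
proof
  assume d: "d \<in> D" and m: "m \<in> keys"
  show "hit (\<sigma> d) (rt m) Q" if "hit d m Q"
    using hit_E[OF that E_rt[OF d m]] hit_base[OF m that] by blast
  show "hit d m Q" if h: "hit (\<sigma> d) (rt m) Q"
  proof -
    have "rg m" using hit_base[OF _ h] m rg_rt by blast
    from E_rt[OF d m this] have "((\<sigma> d, tri (rt m)), (d, tri m)) \<in> E"
      using equiv_E by (meson equivE symD)
    thus ?thesis by (rule hit_E[OF h])
  qed
qed

lemma hit_rf:
  assumes "d \<in> D" "m \<in> keys" "rg m" "hit (\<alpha> d) (rf m) Q"
  shows "hit d m Q"
  using hit_E[OF assms(4) E_rf[of "\<alpha> d" "rf m"]] hit_base[OF _ assms(4)] assms \<alpha>_\<alpha> by auto

text \<open>The triangle with key m, placed in the plane of the copy at d, is in the copy at d or in one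
  of the three copies glued to it, and belongs there to the vertex Q.\<close>
definition sees :: "'d \<Rightarrow> int \<times> int \<Rightarrow> ('d \<times> complex set) set \<Rightarrow> bool" where
  "sees d m Q \<longleftrightarrow> hit d m Q \<or> hit (\<alpha> d) (rf m) Q \<or> hit (\<alpha> (\<sigma> d)) (rf (rt m)) Q
     \<or> hit (\<alpha> (\<sigma> (\<sigma> d))) (rf (rt (rt m))) Q"

lemma sees_cases:
  assumes "d \<in> D" "m \<in> keys" "sees d m Q"
  obtains "hit d m Q"
  | d1 m1 where "d1 \<in> D" "m1 \<in> keys" "hit (\<alpha> d1) (rf m1) Q" "rg (rf m1)"
      "(d1, m1) \<in> {(d, m), (\<sigma> d, rt m), (\<sigma> (\<sigma> d), rt (rt m))}"
  using assms unfolding sees_def by (metis \<sigma>_in hit_base insertI1 insertI2 reflK_in_keys rotK_in_keys)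

lemma sees_hit:
  assumes d: "d \<in> D" and m: "m \<in> keys" and rg: "rg m" and sees: "sees d m Q"
  shows "hit d m Q"
  using d m sees
proof (cases rule: sees_cases)
  case (2 d1 m1)
  have "rg m1" using 2(5) rg by (auto simp: rg_rt)
  hence "hit d1 m1 Q" using hit_rf 2 by blast
  thus ?thesis using 2(5) d m by (auto simp: hit_rt \<sigma>_in)
qed

text \<open>A triangle of T is settled by \<open>sees_hit\<close>; any other lies in at most one
  attached copy by \<open>rg_two_sides\<close>. So \<open>sees d\<close> is a partial function from
  triangles to vertices.\<close>

lemma sees_unique:
  assumes d: "d \<in> D" and m: "m \<in> keys" and sees: "sees d m Q" "sees d m Q'"
  shows "Q = Q'"
proof (cases "rg m")
  case True
  thus ?thesis using sees_hit[OF d m] sees hit_unique by blast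
next
  case False
  have r: "rt m \<in> keys" "rt (rt m) \<in> keys" using m by auto
  have "\<not> (rg (rf m) \<and> rg (rf (rt m)))" using rg_two_sides[OF m] False by blast
  moreover have "\<not> (rg (rf (rt m)) \<and> rg (rf (rt (rt m))))"
    using rg_two_sides[OF r(1)] False rg_rt by blast
  moreover have "\<not> (rg (rf (rt (rt m))) \<and> rg (rf m))"
    using rg_two_sides[OF r(2)] False rg_rt rotK_cubed by metis
  moreover have "rg m1" if "hit d1 m1 P" "m1 \<in> keys" for d1 m1 P using hit_base that by blast
  ultimately show ?thesis
    using sees False m r unfolding sees_def by (metis hit_unique reflK_in_keys)
qed

lemma sees_rt: "d \<in> D \<Longrightarrow> m \<in> keys \<Longrightarrow> sees (\<sigma> d) (rt m) Q \<longleftrightarrow> sees d m Q"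
  using hit_rt unfolding sees_def by (auto simp: \<sigma>_cubed rotK_cubed)

text \<open>Passing to the copy across the edge exchanges the other two attached copies for new
  ones. The claim is therefore restricted to neighbours of a triangle in the overlap, which lie in
  one of the two copies visible from both sides.\<close>

lemma sees_rf:
  assumes d: "d \<in> D" and m: "m \<in> keys" "rg m" "rg (rf m)" and m': "m' \<in> nb m" and s: "sees d m' Q"
  shows "sees (\<alpha> d) (rf m') Q"
proof -
  have k': "m' \<in> keys" using nb_in_keys[OF m(1) m'] .
  from rg_nb_overlap[OF m m'] show ?thesis
  proof
    assume "rg m'"
    hence "hit d m' Q" using sees_hit[OF d k'] s by blast
    thus ?thesis unfolding sees_def using \<alpha>_\<alpha>[OF d] by simp
  next
    assume "rg (rf m')"
    then obtain Q' where h: "hit (\<alpha> d) (rf m') Q'"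
      using hit_exists[OF \<alpha>_in[OF d] reflK_in_keys[OF k']] by blast
    hence "sees d m' Q'" unfolding sees_def by blast
    hence "Q = Q'" using sees_unique[OF d k' s] by blast
    thus ?thesis using h unfolding sees_def by blast
  qed
qed

lemma sees_exists:
  assumes "d \<in> D" "m \<in> keys" "rg m" "m' \<in> nb m"
  shows "\<exists>Q. sees d m' Q"
  using rg_nb[OF assms(2-4)] nb_in_keys[OF assms(2,4)] assms(1) unfolding sees_def
  by (metis \<alpha>_in \<sigma>_in hit_exists reflK_in_keys rotK_in_keys)

definition seen :: "'d \<Rightarrow> int \<times> int \<Rightarrow> ('d \<times> complex set) set set" where
  "seen d m = {Q. \<exists>m'\<in>nb m. sees d m' Q}"

lemma seen_rt:
  assumes "d \<in> D" "m \<in> keys"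
  shows "seen (\<sigma> d) (rt m) = seen d m"
proof -
  have "sees (\<sigma> d) (rt m') Q \<longleftrightarrow> sees d m' Q" if "m' \<in> nb m" for m' Q
    by (rule sees_rt[OF assms(1) nb_in_keys[OF assms(2) that]])
  thus ?thesis unfolding seen_def nb_rotK[OF assms(2)] by (simp cong: bex_cong)
qed

lemma seen_rf:
  assumes "d \<in> D" "m \<in> keys" "rg m" "rg (rf m)"
  shows "seen (\<alpha> d) (rf m) = seen d m"
proof
  have sub: "seen d m \<subseteq> seen (\<alpha> d) (rf m)"
    if "d \<in> D" "m \<in> keys" "rg m" "rg (rf m)" for d m
    using sees_rf[OF that] unfolding seen_def nb_reflK[OF that(2)] by blast
  show "seen d m \<subseteq> seen (\<alpha> d) (rf m)" using sub[OF assms] .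
  show "seen (\<alpha> d) (rf m) \<subseteq> seen d m"
    using sub[OF \<alpha>_in[OF assms(1)] reflK_in_keys[OF assms(2)] assms(4)] assms \<alpha>_\<alpha> by simp
qed

text \<open>Both gluings preserve \<open>seen\<close>, so \<open>E_invariant\<close> applies to it
  as a set-valued function. The neighbours of a vertex can thus be read off at any
  representative.\<close>

lemma seen_cong:
  assumes "hit d m Q" "hit d' m' Q" "m \<in> keys" "m' \<in> keys"
  shows "seen d m = seen d' m'"
  by (rule E_invariant[of seen, OF _ _ hit_imp_E[OF assms(1,2)] assms(3,4)])
     (auto simp: seen_rt seen_rf)

lemma adj_iff:
  assumes h: "hit d m P" and d: "d \<in> D" and m: "m \<in> keys" and Q: "Q \<in> V"
  shows "adj P Q \<longleftrightarrow> P \<noteq> Q \<and> Q \<in> seen d m"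
proof
  assume "adj P Q"
  then obtain d1 t1 d2 t2 where "P \<noteq> Q" and 1: "(d1, t1) \<in> P" "(d2, t2) \<in> Q"
    "d2 = d1 \<and> tri_adj t1 t2 \<or> d2 = \<alpha> d1 \<and> tri_adj t1 (gc_refl (gc_z k l) ` t2)"
    unfolding gc_adj_def by blast
  have P: "P \<in> V" using h by (simp add: hit_def)
  obtain m1 where m1: "t1 = tri m1" "m1 \<in> keys" "hit d1 m1 P" using verts_mem_cases[OF P 1(1)] .
  obtain m2 where m2: "t2 = tri m2" "m2 \<in> keys" "hit d2 m2 Q" using verts_mem_cases[OF Q 1(2)] .
  have "Q \<in> seen d1 m1"
    using 1(3)
  proof (elim disjE conjE)
    assume "d2 = d1" "tri_adj t1 t2"
    thus ?thesis using m1 m2 tri_adj_iff unfolding seen_def sees_def by blast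
  next
    assume "d2 = \<alpha> d1" "tri_adj t1 (gc_refl (gc_z k l) ` t2)"
    hence "rf m2 \<in> nb m1" "hit (\<alpha> d1) (rf (rf m2)) Q"
      using m1 m2 tri_adj_iff[OF m1(2) reflK_in_keys[OF m2(2)]] by (auto simp: gc_refl_tri)
    thus ?thesis unfolding seen_def sees_def by blast
  qed
  thus "P \<noteq> Q \<and> Q \<in> seen d m" using seen_cong[OF h m1(3) m m1(2)] \<open>P \<noteq> Q\<close> by simp
next
  assume "P \<noteq> Q \<and> Q \<in> seen d m"
  then obtain m' where m': "P \<noteq> Q" "m' \<in> nb m" "sees d m' Q" unfolding seen_def by blast
  have k': "m' \<in> keys" using nb_in_keys[OF m m'(2)] .
  \<comment> \<open>Adjacency across an edge refers to the side that belongs to the dart itself; for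
    the other two sides the representative of P is rotated first.\<close>
  have side: "adj P Q" if "hit d1 m1 P" "m1 \<in> keys" "m1' \<in> nb m1" "hit (\<alpha> d1) (rf m1') Q" for d1 m1 m1'
  proof -
    have "m1' \<in> keys" using nb_in_keys that by blast
    hence "tri_adj (tri m1) (gc_refl (gc_z k l) ` tri (rf m1'))"
      using that by (simp add: gc_refl_tri tri_adj_iff)
    thus ?thesis using that \<open>P \<noteq> Q\<close> unfolding gc_adj_def hit_def by blast
  qed
  have rt1: "hit (\<sigma> d) (rt m) P" "rt m' \<in> nb (rt m)"
    using hit_rt[OF d m] h nb_rotK[OF m] m' by auto
  have rt2: "hit (\<sigma> (\<sigma> d)) (rt (rt m)) P" "rt (rt m') \<in> nb (rt (rt m))"
    using hit_rt[of "\<sigma> d" "rt m"] rt1 nb_rotK[of "rt m"] m \<sigma>_in[OF d] by auto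
  from m'(3) show "adj P Q" unfolding sees_def
  proof (elim disjE)
    assume "hit d m' Q"
    thus ?thesis using h m' tri_adj_iff[OF m k'] unfolding gc_adj_def hit_def by blast
  next
    assume "hit (\<alpha> d) (rf m') Q"
    thus ?thesis by (rule side[OF h m m'(2)])
  next
    assume "hit (\<alpha> (\<sigma> d)) (rf (rt m')) Q"
    thus ?thesis by (rule side[OF rt1(1) rotK_in_keys[OF m] rt1(2)])
  next
    assume "hit (\<alpha> (\<sigma> (\<sigma> d))) (rf (rt (rt m'))) Q"
    thus ?thesis by (rule side[OF rt2(1) rotK_in_keys[OF rotK_in_keys[OF m]] rt2(2)])
  qed
qed

text \<open>Required for all keys, also outside T: the value at a triangle beyond a side then agrees
  with the value in the copy attached there, and sums over \<open>nb\<close> can be computed in the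
  plane of d.\<close>

definition compatible :: "('d \<Rightarrow> int \<times> int \<Rightarrow> 'c) \<Rightarrow> bool" where
  "compatible \<psi> \<longleftrightarrow> (\<forall>d\<in>D. \<forall>m\<in>keys. \<psi> (\<sigma> d) (rt m) = \<psi> d m \<and> \<psi> (\<alpha> d) (rf m) = \<psi> d m)"

lemma compatible_hit:
  assumes "compatible \<psi>" "hit d m Q" "hit d' m' Q" "m \<in> keys" "m' \<in> keys"
  shows "\<psi> d m = \<psi> d' m'"
  by (rule E_invariant[of \<psi>, OF _ _ hit_imp_E[OF assms(2,3)] assms(4,5)])
     (use assms(1) in \<open>auto simp: compatible_def\<close>)

definition descend :: "('d \<Rightarrow> int \<times> int \<Rightarrow> 'c) \<Rightarrow> ('d \<times> complex set) set \<Rightarrow> 'c" where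
  "descend \<psi> Q = (let x = (SOME x. x \<in> Q) in \<psi> (fst x) (key (snd x)))"

lemma descend_hit:
  assumes "compatible \<psi>" "hit d m Q" "m \<in> keys"
  shows "descend \<psi> Q = \<psi> d m"
proof -
  define x where "x = (SOME x. x \<in> Q)"
  have "x \<in> Q" unfolding x_def using assms(2) by (auto simp: hit_def intro: someI)
  moreover have "Q \<in> V" using assms(2) by (simp add: hit_def)
  ultimately obtain m' where m': "snd x = tri m'" "m' \<in> keys" "hit (fst x) m' Q"
    using verts_mem_cases[of Q "fst x" "snd x"] by auto
  have "descend \<psi> Q = \<psi> (fst x) m'" unfolding descend_def using m' by (simp flip: x_def)
  also have "\<dots> = \<psi> d m" using compatible_hit[OF assms(1) m'(3) assms(2) m'(2) assms(3)] .
  finally show ?thesis .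
qed

lemma descend_sees:
  assumes c: "compatible \<psi>" and d: "d \<in> D" and m: "m \<in> keys" and s: "sees d m Q"
  shows "descend \<psi> Q = \<psi> d m"
  using d m s
proof (cases rule: sees_cases)
  case 1
  thus ?thesis using descend_hit[OF c _ m] by blast
next
  case (2 d1 m1)
  have "descend \<psi> Q = \<psi> (\<alpha> d1) (rf m1)" using descend_hit[OF c 2(3)] 2(2) by auto
  also have "\<dots> = \<psi> d1 m1" using c 2 by (simp add: compatible_def)
  also have "\<dots> = \<psi> d m" using c 2(5) d m \<sigma>_in by (auto simp: compatible_def)
  finally show ?thesis .
qed

text \<open>The auxiliary \<open>col\<close> separates m and its three neighbours and descends to
  the graph. So these triangles remain four different vertices, and P has degree 3.\<close>

lemma laplacian_descend:
  fixes \<psi> :: "'d \<Rightarrow> int \<times> int \<Rightarrow> complex"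
  assumes h: "hit d m P" and d: "d \<in> D" and m: "m \<in> keys"
    and col: "compatible col" "inj_on (col d) (insert m (nb m))" "m \<notin> nb m" "card (nb m) = 3"
    and \<psi>: "compatible \<psi>"
  shows "laplacian V adj (\<lambda>Q. if Q \<in> V then descend \<psi> Q else 0) P
           = 3 * descend \<psi> P - (\<Sum>m'\<in>nb m. \<psi> d m')"
proof -
  have rg: "rg m" using hit_base[OF m h] by blast
  define q where "q = (\<lambda>m'. SOME Q. sees d m' Q)"
  have q: "sees d m' (q m')" if "m' \<in> nb m" for m'
    unfolding q_def using sees_exists[OF d m rg that] by (rule someI_ex)
  have k': "m' \<in> keys" if "m' \<in> nb m" for m' using nb_in_keys[OF m that] .
  have qV: "q m' \<in> V" if "m' \<in> nb m" for m'
    using q[OF that] by (auto simp: sees_def hit_def)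
  have inj: "inj_on q (nb m)"
  proof (rule inj_onI)
    fix m1 m2 assume "m1 \<in> nb m" "m2 \<in> nb m" "q m1 = q m2"
    hence "col d m1 = col d m2"
      using descend_sees[OF col(1) d k' q, of m1] descend_sees[OF col(1) d k' q, of m2] by simp
    thus "m1 = m2" using col(2) \<open>m1 \<in> nb m\<close> \<open>m2 \<in> nb m\<close> by (auto dest: inj_onD)
  qed
  have neq: "P \<noteq> q m'" if "m' \<in> nb m" for m'
  proof
    assume "P = q m'"
    hence "col d m = col d m'"
      using descend_hit[OF col(1) h m] descend_sees[OF col(1) d k'[OF that] q[OF that]] by simp
    hence "m = m'" using col(2) that by (auto dest: inj_onD)
    thus False using col(3) that by simp
  qed
  have "nbrs V adj P = q ` nb m"
  proof
    show "q ` nb m \<subseteq> nbrs V adj P"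
    proof
      fix Q assume "Q \<in> q ` nb m"
      then obtain m' where m': "m' \<in> nb m" "Q = q m'" by blast
      have "Q \<in> V" "P \<noteq> Q" "Q \<in> seen d m"
        using qV[OF m'(1)] neq[OF m'(1)] q[OF m'(1)] m' by (auto simp: seen_def)
      thus "Q \<in> nbrs V adj P" using adj_iff[OF h d m] by (simp add: nbrs_def)
    qed
    show "nbrs V adj P \<subseteq> q ` nb m"
    proof
      fix Q assume "Q \<in> nbrs V adj P"
      hence "Q \<in> V" "adj P Q" by (simp_all add: nbrs_def)
      hence "Q \<in> seen d m" using adj_iff[OF h d m, of Q] by blast
      then obtain m' where m': "m' \<in> nb m" "sees d m' Q" unfolding seen_def by blast
      have "Q = q m'" using sees_unique[OF d k'[OF m'(1)] m'(2) q[OF m'(1)]] .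
      thus "Q \<in> q ` nb m" using m' by blast
    qed
  qed
  moreover have "(\<Sum>Q\<in>q ` nb m. if Q \<in> V then descend \<psi> Q else 0) = (\<Sum>m'\<in>nb m. \<psi> d m')"
    unfolding sum.reindex[OF inj] comp_def
    using qV descend_sees[OF \<psi> d k' q] by (intro sum.cong) auto
  moreover have "P \<in> V" using h by (simp add: hit_def)
  ultimately show ?thesis
    by (simp add: laplacian_def card_image[OF inj] col(4))
qed

end

section \<open>Half-turn invariant functions on the lattice triangles\<close>

text \<open>Multiplication by \<open>\<omega>\<^sup>2\<close> in lattice coordinates.\<close>
definition turn :: "int \<times> int \<Rightarrow> int \<times> int" where
  "turn m = (- fst m - snd m, fst m)"

text \<open>The triple (r, u, v) stands for the isometry that takes w to \<open>\<omega>^(2r) * w + (u + v * \<omega>) * z\<close>, modulo the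
  half-turns about the points of z Z[\<omega>]. These 12 classes are the darts of the tetrahedron graph.\<close>
definition K4 :: "(int \<times> int \<times> int) set" where
  "K4 = {0, 1, 2} \<times> {0, 1} \<times> {0, 1}"

definition place :: "int \<Rightarrow> int \<Rightarrow> int \<times> int \<times> int \<Rightarrow> int \<times> int \<Rightarrow> int \<times> int" where
  "place k l \<kappa> m = (case \<kappa> of (r, u, v) \<Rightarrow>
     (let n = (if r = 0 then m else if r = 1 then turn m else turn (turn m))
      in (fst n + 3 * (u * k - v * l), snd n + 3 * (u * l + v * (k + l)))))"

text \<open>Composition with the inverse of \<open>gc_rot\<close>, which maps w to \<omega>^2 w + z.
  The translation part grows by \<omega>^(2r) z, that is by z times 1, \<omega> - 1 or -
  \<omega>.\<close>

definition rot4 :: "int \<times> int \<times> int \<Rightarrow> int \<times> int \<times> int" where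
  "rot4 \<kappa> = (case \<kappa> of (r, u, v) \<Rightarrow>
     if r = 0 then (1, (u + 1) mod 2, v mod 2)
     else if r = 1 then (2, (u - 1) mod 2, (v + 1) mod 2)
     else (0, u mod 2, (v - 1) mod 2))"

text \<open>Composition with \<open>gc_refl\<close> reverses the sign of the linear part, and the
  half-turn about 0 restores it. The new translation part is z times - (u + v \<omega>) -
  \<omega>^(2r) (1 + \<omega>).\<close>

definition flip4 :: "int \<times> int \<times> int \<Rightarrow> int \<times> int \<times> int" where
  "flip4 \<kappa> = (case \<kappa> of (r, u, v) \<Rightarrow>
     if r = 0 then (0, (- u - 1) mod 2, (- v - 1) mod 2)
     else if r = 1 then (1, (- u + 2) mod 2, (- v - 1) mod 2)
     else (2, (- u - 1) mod 2, (- v + 2) mod 2))"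

lemma K4_cases:
  assumes "\<kappa> \<in> K4"
  obtains r u v where "\<kappa> = (r, u, v)" "r = 0 \<or> r = 1 \<or> r = 2" "u = 0 \<or> u = 1" "v = 0 \<or> v = 1"
  using assms by (auto simp: K4_def)

lemma rot4_in: "\<kappa> \<in> K4 \<Longrightarrow> rot4 \<kappa> \<in> K4"
  and flip4_in: "\<kappa> \<in> K4 \<Longrightarrow> flip4 \<kappa> \<in> K4"
  by (auto elim!: K4_cases simp: rot4_def flip4_def K4_def)

text \<open>The third identity holds because \<open>gc_rot\<close> after \<open>gc_refl\<close> is
  the rotation by 60 degrees about the corner z, whose cube is a half-turn. It is the trivial
  monodromy around a face of length 3.\<close>

lemma rot4_cubed: "\<kappa> \<in> K4 \<Longrightarrow> rot4 (rot4 (rot4 \<kappa>)) = \<kappa>"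
  and flip4_flip4: "\<kappa> \<in> K4 \<Longrightarrow> flip4 (flip4 \<kappa>) = \<kappa>"
  and rot4_flip4_cubed: "\<kappa> \<in> K4 \<Longrightarrow> rot4 (flip4 (rot4 (flip4 (rot4 (flip4 \<kappa>))))) = \<kappa>"
  by (auto elim!: K4_cases simp: rot4_def flip4_def)

lemma finite_K4: "finite K4" and zero_in_K4: "(0, 0, 0) \<in> K4"
  by (auto simp: K4_def)

lemma bij_rot4: "bij_betw rot4 K4 K4"
  by (rule bij_betwI[where g = "rot4 \<circ> rot4"]) (auto simp: rot4_in rot4_cubed)

lemma place_zero [simp]: "place k l (0, 0, 0) m = m"
  by (simp add: place_def)

lemma turn_up: "turn (3 * a + 1, 3 * b + 1) = (3 * (- a - b - 1) + 1, 3 * a + 1)"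
  and turn_down: "turn (3 * a + 2, 3 * b + 2) = (3 * (- a - b - 2) + 2, 3 * a + 2)"
  by (simp_all add: turn_def)

lemma turn_in_keys: "m \<in> keys \<Longrightarrow> turn m \<in> keys"
  by (erule keys_cases) (simp_all only: turn_up turn_down up_in_keys down_in_keys)

lemma nb_turn: "m \<in> keys \<Longrightarrow> nb (turn m) = turn ` nb m"
  by (erule keys_cases)
     (simp_all only: turn_up turn_down nb_up nb_down image_insert image_empty, auto)

lemma translate_in_keys: "m \<in> keys \<Longrightarrow> (fst m + 3 * i, snd m + 3 * j) \<in> keys"
  by (auto simp: keys_def)

lemma nb_translate:
  "nb (fst m + 3 * i, snd m + 3 * j) = (\<lambda>m. (fst m + 3 * i, snd m + 3 * j)) ` nb m"
  by (auto simp: nb_def Let_def)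

lemma place_eq:
  "place k l (r, u, v) = (\<lambda>m. (fst m + 3 * (u * k - v * l), snd m + 3 * (u * l + v * (k + l))))
     \<circ> (if r = 0 then id else if r = 1 then turn else turn \<circ> turn)"
  by (auto simp: place_def fun_eq_iff Let_def)

lemma place_in_keys: "m \<in> keys \<Longrightarrow> place k l \<kappa> m \<in> keys"
proof (cases \<kappa>)
  fix r u v assume m: "m \<in> keys" and \<kappa>: "\<kappa> = (r, u, v)"
  have "(if r = 0 then id else if r = 1 then turn else turn \<circ> turn) m \<in> keys"
    using m by (simp add: turn_in_keys)
  thus ?thesis unfolding \<kappa> place_eq comp_apply by (rule translate_in_keys)
qed

lemma nb_place: "m \<in> keys \<Longrightarrow> nb (place k l \<kappa> m) = place k l \<kappa> ` nb m"
proof (cases \<kappa>)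
  fix r u v assume m: "m \<in> keys" and \<kappa>: "\<kappa> = (r, u, v)"
  have "nb ((if r = 0 then id else if r = 1 then turn else turn \<circ> turn) m)
      = (if r = 0 then id else if r = 1 then turn else turn \<circ> turn) ` nb m"
    using m by (simp add: turn_in_keys nb_turn image_comp)
  thus ?thesis unfolding \<kappa> place_eq comp_apply[of "\<lambda>m. _ m"] nb_translate image_comp[symmetric]
    by (rule arg_cong)
qed

lemma inj_place: "inj (place k l \<kappa>)"
proof -
  have t: "inj turn" by (rule injI) (auto simp: turn_def prod_eq_iff)
  have "inj (\<lambda>m. (fst m + a, snd m + b))" for a b :: int by (rule injI) (auto simp: prod_eq_iff)
  thus ?thesis using t inj_compose[OF t t] by (cases \<kappa>) (auto simp: place_eq intro!: inj_compose)
qed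

text \<open>The half-turn about k p, for p in Z[\<omega>], is the half-turn about 0 followed by the
  translation by 2 k p; in tripled coordinates 2 k becomes 6 k.\<close>

definition halfturn_invariant :: "nat \<Rightarrow> (int \<times> int \<Rightarrow> 'c) \<Rightarrow> bool" where
  "halfturn_invariant k H \<longleftrightarrow> (\<forall>A B. (A, B) \<in> keys \<longrightarrow>
     H (- A, - B) = H (A, B) \<and> H (A + 6 * int k, B) = H (A, B) \<and> H (A, B + 6 * int k) = H (A, B))"

lemma halfturn_invariant_translate:
  assumes H: "halfturn_invariant k H" and m: "(A, B) \<in> keys"
  shows "H (A + 6 * int k * i, B + 6 * int k * j) = H (A, B)"
proof -
  have keys: "(A + 6 * int k * i, B + 6 * int k * j) \<in> keys" for i j
    using translate_in_keys[OF m, of "2 * int k * i" "2 * int k * j"] by (simp add: mult.assoc)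
  have x: "H (A + 6 * int k * (i + 1), B + 6 * int k * j) = H (A + 6 * int k * i, B + 6 * int k * j)"
    and y: "H (A + 6 * int k * i, B + 6 * int k * (j + 1)) = H (A + 6 * int k * i, B + 6 * int k * j)"
    for i j
  proof -
    have e: "x + 6 * int k * (i + 1) = x + 6 * int k * i + 6 * int k" for x i
      by (simp add: algebra_simps)
    show "H (A + 6 * int k * (i + 1), B + 6 * int k * j) = H (A + 6 * int k * i, B + 6 * int k * j)"
      and "H (A + 6 * int k * i, B + 6 * int k * (j + 1)) = H (A + 6 * int k * i, B + 6 * int k * j)"
      unfolding e using H keys[of i j] unfolding halfturn_invariant_def by blast+
  qed
  have X: "H (A + 6 * int k * i, B + 6 * int k * j) = H (A, B + 6 * int k * j)" for i j
  proof (induction i rule: int_induct[of _ 0])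
    case (step1 i) thus ?case using x[of i j] by simp
  next
    case (step2 i) thus ?case using x[of "i - 1" j] by simp
  qed simp
  have "H (A, B + 6 * int k * j) = H (A, B)" for j
  proof (induction j rule: int_induct[of _ 0])
    case (step1 j) thus ?case using y[of 0 j] by simp
  next
    case (step2 j) thus ?case using y[of 0 "j - 1"] by simp
  qed simp
  thus ?thesis using X by simp
qed

context region
begin

lemma place_mod_2:
  assumes H: "halfturn_invariant k H" and m: "m \<in> keys"
  shows "H (place (int k) (int l) (r, u mod 2, v mod 2) m) = H (place (int k) (int l) (r, u, v) m)"
proof -
  define n where "n = (if r = 0 then m else if r = 1 then turn m else turn (turn m))"
  have P: "place (int k) (int l) (r, u, v) m
      = (fst n + 3 * (u * int k - v * int l), snd n + 3 * (u * int l + v * (int k + int l)))" for u v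
    by (simp add: place_def n_def Let_def)
  have keys: "(fst n + 3 * (u * int k - v * int l), snd n + 3 * (u * int l + v * (int k + int l))) \<in> keys"
    using place_in_keys[OF m, of "int k" "int l" "(r, u, v)"] unfolding P .
  \<comment> \<open>This is where l = 0 or l = k enters: reducing u and v modulo 2 translates by a
    lattice multiple of 2 z, and z is divisible by k.\<close>
  obtain c where c: "int l = c * int k" using kl that[of 0] that[of 1] by auto
  define x y where "x = u div 2" and "y = v div 2"
  have u: "u mod 2 = u - 2 * x" and v: "v mod 2 = v - 2 * y"
    by (simp_all add: x_def y_def minus_mult_div_eq_mod)
  have e: "fst n + 3 * ((u - 2 * x) * int k - (v - 2 * y) * int l)
      = fst n + 3 * (u * int k - v * int l) + 6 * int k * (c * y - x)"
    "snd n + 3 * ((u - 2 * x) * int l + (v - 2 * y) * (int k + int l))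
      = snd n + 3 * (u * int l + v * (int k + int l)) + 6 * int k * (- c * x - (1 + c) * y)"
    unfolding c by (simp_all add: algebra_simps)
  show ?thesis unfolding P u v e by (rule halfturn_invariant_translate[OF H keys])
qed

lemma place_rot:
  assumes H: "halfturn_invariant k H" and \<kappa>: "\<kappa> \<in> K4" and m: "m \<in> keys"
  shows "H (place (int k) (int l) (rot4 \<kappa>) (rt m)) = H (place (int k) (int l) \<kappa> m)"
proof -
  obtain r u v where k: "\<kappa> = (r, u, v)" by (cases \<kappa>)
  hence r_cases: "r = 0 \<or> r = 1 \<or> r = 2" using \<kappa> by (auto simp: K4_def)
  note P = place_mod_2[OF H rotK_in_keys[OF m]]
  show ?thesis using r_cases
  proof (elim disjE)
    assume r: "r = 0"
    have "place (int k) (int l) (1, u + 1, v) (rt m) = place (int k) (int l) (0, u, v) m"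
      by (rule prod_eqI) (simp_all add: place_def rotK_def turn_def ring_distribs)
    moreover have "rot4 (0, u, v) = (1, (u + 1) mod 2, v mod 2)" by (simp add: rot4_def)
    ultimately show ?thesis unfolding k r by (simp only: P)
  next
    assume r: "r = 1"
    have "place (int k) (int l) (2, u - 1, v + 1) (rt m) = place (int k) (int l) (1, u, v) m"
      by (rule prod_eqI) (simp_all add: place_def rotK_def turn_def ring_distribs)
    moreover have "rot4 (1, u, v) = (2, (u - 1) mod 2, (v + 1) mod 2)" by (simp add: rot4_def)
    ultimately show ?thesis unfolding k r by (simp only: P)
  next
    assume r: "r = 2"
    have "place (int k) (int l) (0, u, v - 1) (rt m) = place (int k) (int l) (2, u, v) m"
      by (rule prod_eqI) (simp_all add: place_def rotK_def turn_def ring_distribs)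
    moreover have "rot4 (2, u, v) = (0, u mod 2, (v - 1) mod 2)" by (simp add: rot4_def)
    ultimately show ?thesis unfolding k r by (simp only: P)
  qed
qed

lemma place_flip:
  assumes H: "halfturn_invariant k H" and \<kappa>: "\<kappa> \<in> K4" and m: "m \<in> keys"
  shows "H (place (int k) (int l) (flip4 \<kappa>) (rf m)) = H (place (int k) (int l) \<kappa> m)"
proof -
  obtain r u v where k: "\<kappa> = (r, u, v)" by (cases \<kappa>)
  hence r_cases: "r = 0 \<or> r = 1 \<or> r = 2" using \<kappa> by (auto simp: K4_def)
  note P = place_mod_2[OF H reflK_in_keys[OF m]]
  \<comment> \<open>The half-turn about 0 that is built into \<open>flip4\<close> is absorbed by the
    invariance of H.\<close>
  have neg: "H (- fst n, - snd n) = H n" if "n \<in> keys" for n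
    using H that unfolding halfturn_invariant_def by (metis prod.collapse)
  note neg = neg[OF place_in_keys[OF m, of "int k" "int l" \<kappa>]]
  show ?thesis using r_cases
  proof (elim disjE)
    assume r: "r = 0"
    have "place (int k) (int l) (0, - u - 1, - v - 1) (rf m)
        = (- fst (place (int k) (int l) \<kappa> m), - snd (place (int k) (int l) \<kappa> m))"
      by (rule prod_eqI) (simp_all add: k r place_def reflK_def turn_def ring_distribs)
    moreover have "flip4 \<kappa> = (0, (- u - 1) mod 2, (- v - 1) mod 2)" by (simp add: k r flip4_def)
    ultimately show ?thesis by (simp only: P neg)
  next
    assume r: "r = 1"
    have "place (int k) (int l) (1, - u + 2, - v - 1) (rf m)
        = (- fst (place (int k) (int l) \<kappa> m), - snd (place (int k) (int l) \<kappa> m))"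
      by (rule prod_eqI) (simp_all add: k r place_def reflK_def turn_def ring_distribs)
    moreover have "flip4 \<kappa> = (1, (- u + 2) mod 2, (- v - 1) mod 2)" by (simp add: k r flip4_def)
    ultimately show ?thesis by (simp only: P neg)
  next
    assume r: "r = 2"
    have "place (int k) (int l) (2, - u - 1, - v + 2) (rf m)
        = (- fst (place (int k) (int l) \<kappa> m), - snd (place (int k) (int l) \<kappa> m))"
      by (rule prod_eqI) (simp_all add: k r place_def reflK_def turn_def ring_distribs)
    moreover have "flip4 \<kappa> = (2, (- u - 1) mod 2, (- v + 2) mod 2)" by (simp add: k r flip4_def)
    ultimately show ?thesis by (simp only: P neg)
  qed
qed

end

text \<open>An invariant that separates a vertex and its three neighbours, so that the Goldberg--Coxeter graph is
  3-valent even after the identifications. It is the covering of the tetrahedron graph for z = 1.\<close>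
definition colour :: "int \<times> int \<Rightarrow> int \<times> int" where
  "colour m = (fst m mod 2, snd m mod 2)"

lemma colour_invariant: "halfturn_invariant k colour"
proof -
  have "(- A) mod 2 = A mod 2" "(A + 6 * int k) mod 2 = A mod 2" for A :: int
    by presburger+
  thus ?thesis by (simp add: halfturn_invariant_def colour_def)
qed

text \<open>Modulo 2 the three steps of \<open>nb\<close> are \<open>(1, 1)\<close>,
  \<open>(0, 1)\<close> and \<open>(1, 0)\<close>, so a triangle and its neighbours have all four
  colours.\<close>

lemma nb_distinct:
  assumes "m \<in> keys"
  shows "inj_on colour (insert m (nb m))" "m \<notin> nb m" "card (nb m) = 3"
  using assms
proof (atomize (full), cases rule: keys_cases)
  case (up a b)
  show "inj_on colour (insert m (nb m)) \<and> m \<notin> nb m \<and> card (nb m) = 3"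
    unfolding up nb_up by (auto simp: colour_def; presburger)
next
  case (down a b)
  show "inj_on colour (insert m (nb m)) \<and> m \<notin> nb m \<and> card (nb m) = 3"
    unfolding down nb_down by (auto simp: colour_def; presburger)
qed

section \<open>Eigenfunctions on the plane\<close>

definition wave :: "complex \<Rightarrow> (int \<Rightarrow> complex) \<Rightarrow> int \<times> int \<Rightarrow> complex" where
  "wave \<mu> g m = (let s = (if even (fst m div 3) then 1 else -1); b = snd m div 3 in
     if fst m mod 3 = 1 then s * g b else \<mu> * s * g (b + 1))"

lemma wave_up: "wave \<mu> g (3 * a + 1, 3 * b + 1) = (if even a then 1 else -1) * g b"
proof -
  have "(3 * a + 1) div 3 = a" "(3 * b + 1) div 3 = b" "(3 * a + 1) mod 3 = 1" by presburger+
  thus ?thesis by (simp add: wave_def)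
qed

lemma wave_down: "wave \<mu> g (3 * a + 2, 3 * b + 2) = \<mu> * (if even a then 1 else -1) * g (b + 1)"
proof -
  have "(3 * a + 2) div 3 = a" "(3 * b + 2) div 3 = b" "(3 * a + 2) mod 3 = 2" by presburger+
  thus ?thesis by (simp add: wave_def)
qed

text \<open>The signs of the two neighbours in the direction of the first coordinate cancel, so only the
  third neighbour contributes.\<close>
lemma wave_nb:
  assumes m: "m \<in> keys" and \<mu>: "\<mu> * \<mu> = 1"
  shows "(\<Sum>n\<in>nb m. wave \<mu> g n) = \<mu> * wave \<mu> g m"
  using m
proof (cases rule: keys_cases)
  case (up a b)
  have "(\<Sum>n\<in>nb m. wave \<mu> g n) = wave \<mu> g (3 * a + 2, 3 * b + 2) +
      (wave \<mu> g (3 * (a - 1) + 2, 3 * b + 2) + wave \<mu> g (3 * a + 2, 3 * (b - 1) + 2))"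
    unfolding up nb_up by simp
  thus ?thesis unfolding wave_down up wave_up by simp
next
  case (down a b)
  have "(\<Sum>n\<in>nb m. wave \<mu> g n) = wave \<mu> g (3 * a + 1, 3 * b + 1) +
      (wave \<mu> g (3 * (a + 1) + 1, 3 * b + 1) + wave \<mu> g (3 * a + 1, 3 * (b + 1) + 1))"
    unfolding down nb_down by simp
  thus ?thesis unfolding wave_down down wave_up using \<mu> by (simp flip: mult.assoc)
qed

text \<open>The half-turn about 0 exchanges the upward triangle at (a, b) with the downward one at
  (- a - 1, - b - 1). The change of parity of a causes the minus sign in the condition on g, and the
  shift in \<open>g (b + 1)\<close> makes the index b become - b. Translations in the first
  direction keep the sign because 2 k is even.\<close>

lemma wave_invariant:
  assumes \<mu>: "\<mu> * \<mu> = 1" and g: "\<And>b. g (- b) = - \<mu> * g b" "\<And>b. g (b + 2 * int k) = g b"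
  shows "halfturn_invariant k (wave \<mu> g)"
  unfolding halfturn_invariant_def
proof (intro allI impI)
  fix A B assume "(A, B) \<in> keys"
  thus "wave \<mu> g (- A, - B) = wave \<mu> g (A, B) \<and> wave \<mu> g (A + 6 * int k, B) = wave \<mu> g (A, B) \<and>
    wave \<mu> g (A, B + 6 * int k) = wave \<mu> g (A, B)"
  proof (cases rule: keys_cases)
    case (up a b)
    have "(- A, - B) = (3 * (- a - 1) + 2, 3 * (- b - 1) + 2)"
      "(A + 6 * int k, B) = (3 * (a + 2 * int k) + 1, 3 * b + 1)"
      "(A, B + 6 * int k) = (3 * a + 1, 3 * (b + 2 * int k) + 1)" "(A, B) = (3 * a + 1, 3 * b + 1)"
      using up by simp_all
    thus ?thesis using \<mu> g by (simp only: wave_up wave_down) (simp flip: mult.assoc)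
  next
    case (down a b)
    have "(- A, - B) = (3 * (- a - 1) + 1, 3 * (- b - 1) + 1)"
      "(A + 6 * int k, B) = (3 * (a + 2 * int k) + 2, 3 * b + 2)"
      "(A, B + 6 * int k) = (3 * a + 2, 3 * (b + 2 * int k) + 2)" "(A, B) = (3 * a + 2, 3 * b + 2)"
      using down by simp_all
    moreover have "g (- b - 1) = - \<mu> * g (b + 1)" "g (b + 2 * int k + 1) = g (b + 1)"
    proof -
      have e: "- b - 1 = - (b + 1)" "b + 2 * int k + 1 = b + 1 + 2 * int k" by simp_all
      show "g (- b - 1) = - \<mu> * g (b + 1)" "g (b + 2 * int k + 1) = g (b + 1)"
        unfolding e by (rule g)+
    qed
    ultimately show ?thesis by (simp only: wave_up wave_down) simp
  qed
qed

section \<open>Multiplicities of the eigenvalues 4 and 2\<close>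

locale planar_gc = gc k l D \<alpha> \<sigma> for k l and D :: "'d set" and \<alpha> \<sigma> +
  fixes \<pi> :: "'d \<Rightarrow> int \<times> int \<times> int" and d0 :: 'd
  assumes \<pi>_in: "d \<in> D \<Longrightarrow> \<pi> d \<in> K4"
    and \<pi>_\<sigma>: "d \<in> D \<Longrightarrow> \<pi> (\<sigma> d) = rot4 (\<pi> d)"
    and \<pi>_\<alpha>: "d \<in> D \<Longrightarrow> \<pi> (\<alpha> d) = flip4 (\<pi> d)"
    and d0: "d0 \<in> D" "\<pi> d0 = (0, 0, 0)"
begin

definition pull :: "(int \<times> int \<Rightarrow> 'c) \<Rightarrow> 'd \<Rightarrow> int \<times> int \<Rightarrow> 'c" where
  "pull H d m = H (place (int k) (int l) (\<pi> d) m)"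

lemma compatible_pull: "halfturn_invariant k H \<Longrightarrow> compatible (pull H)"
  unfolding compatible_def pull_def
  by (simp add: \<pi>_\<sigma> \<pi>_\<alpha> \<pi>_in place_rot place_flip)

lemma inj_on_pull_colour:
  assumes "m \<in> keys"
  shows "inj_on (pull colour d) (insert m (nb m))"
proof -
  let ?p = "place (int k) (int l) (\<pi> d)"
  have "inj_on colour (?p ` insert m (nb m))"
    using nb_distinct(1)[OF place_in_keys[OF assms]] by (simp add: nb_place[OF assms])
  moreover have "inj_on ?p (insert m (nb m))" using inj_place by (rule inj_on_subset) simp
  ultimately have "inj_on (colour \<circ> ?p) (insert m (nb m))" by (rule comp_inj_on[rotated])
  thus ?thesis by (simp add: pull_def[abs_def] comp_def)
qed

definition wave_on_V :: "complex \<Rightarrow> (int \<Rightarrow> complex) \<Rightarrow> ('d \<times> complex set) set \<Rightarrow> complex" where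
  "wave_on_V \<mu> g Q = (if Q \<in> V then descend (pull (wave \<mu> g)) Q else 0)"

lemma wave_on_V_eigen:
  assumes \<mu>: "\<mu> * \<mu> = 1" and g: "\<And>b. g (- b) = - \<mu> * g b" "\<And>b. g (b + 2 * int k) = g b"
  shows "wave_on_V \<mu> g \<in> lap_eigenspace V adj (3 - \<mu>)"
proof -
  have c: "compatible (pull (wave \<mu> g))" by (rule compatible_pull[OF wave_invariant[OF \<mu> g]])
  have "laplacian V adj (wave_on_V \<mu> g) P = (3 - \<mu>) * wave_on_V \<mu> g P" if P: "P \<in> V" for P
  proof -
    obtain d m where h: "hit d m P" and d: "d \<in> D" and m: "m \<in> keys" using verts_cases[OF P] .
    let ?p = "place (int k) (int l) (\<pi> d)"
    have "laplacian V adj (wave_on_V \<mu> g) P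
        = 3 * descend (pull (wave \<mu> g)) P - (\<Sum>m'\<in>nb m. pull (wave \<mu> g) d m')"
      unfolding wave_on_V_def[abs_def]
      by (rule laplacian_descend[OF h d m compatible_pull[OF colour_invariant]
            inj_on_pull_colour[OF m] nb_distinct(2,3)[OF m] c])
    also have "(\<Sum>m'\<in>nb m. pull (wave \<mu> g) d m') = (\<Sum>n\<in>nb (?p m). wave \<mu> g n)"
      unfolding nb_place[OF m] pull_def
      by (simp add: sum.reindex[OF inj_on_subset[OF inj_place subset_UNIV]])
    also have "\<dots> = \<mu> * pull (wave \<mu> g) d m"
      unfolding pull_def by (rule wave_nb[OF place_in_keys[OF m] \<mu>])
    also have "pull (wave \<mu> g) d m = descend (pull (wave \<mu> g)) P"
      by (rule descend_hit[OF c h m, symmetric])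
    finally have "laplacian V adj (wave_on_V \<mu> g) P
        = 3 * descend (pull (wave \<mu> g)) P - \<mu> * descend (pull (wave \<mu> g)) P" .
    moreover have "wave_on_V \<mu> g P = descend (pull (wave \<mu> g)) P" using P by (simp add: wave_on_V_def)
    ultimately show ?thesis by (simp add: left_diff_distrib)
  qed
  thus ?thesis by (simp add: lap_eigenspace_def wave_on_V_def)
qed

text \<open>The vertex depends on i alone, so one choice serves as evaluation point for a whole
  family of functions g.\<close>

lemma wave_on_V_point:
  assumes i: "0 \<le> i" "i \<le> int k"
  obtains Q where "\<And>\<mu> g. \<mu> * \<mu> = 1 \<Longrightarrow> (\<And>b. g (- b) = - \<mu> * g b) \<Longrightarrow> (\<And>b. g (b + 2 * int k) = g b)
    \<Longrightarrow> wave_on_V \<mu> g Q \<noteq> 0 \<longleftrightarrow> g i \<noteq> 0"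
proof -
  \<comment> \<open>The downward triangle at (0, i - 1) carries \<mu> * g i. For l = 0 and i = k it
    lies just beyond the side from z to \<omega> z, in the attached copy. For i = 0 the upward
    triangle at the corner 0 is taken.\<close>
  define m :: "int \<times> int" where "m = (if i = 0 then (3 * 0 + 1, 3 * 0 + 1) else (3 * 0 + 2, 3 * (i - 1) + 2))"
  have m: "m \<in> keys" unfolding m_def using up_in_keys[of 0 0] down_in_keys[of 0 "i - 1"] by simp
  have "rg m \<or> rg (rf m)"
    using kl k_pos i by (auto simp: m_def reg_simps[OF k_pos] reflK_def)
  then obtain Q where s: "sees d0 m Q"
    using hit_exists[OF d0(1) m] hit_exists[OF \<alpha>_in[OF d0(1)] reflK_in_keys[OF m]] unfolding sees_def
    by blast
  have Q: "Q \<in> V" using s by (auto simp: sees_def hit_def)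
  show ?thesis
  proof (rule that[of Q])
    fix \<mu> :: complex and g
    assume \<mu>: "\<mu> * \<mu> = 1" and g: "\<And>b. g (- b) = - \<mu> * g b" "\<And>b. g (b + 2 * int k) = g b"
    have "wave_on_V \<mu> g Q = pull (wave \<mu> g) d0 m"
      using descend_sees[OF compatible_pull[OF wave_invariant[OF \<mu> g]] d0(1) m s] Q
      by (simp add: wave_on_V_def)
    also have "\<dots> = wave \<mu> g m" by (simp add: pull_def d0(2))
    also have "\<dots> = (if i = 0 then g i else \<mu> * g i)"
      unfolding m_def using wave_up[of \<mu> g 0 0] wave_down[of \<mu> g 0 "i - 1"] by simp
    finally show "wave_on_V \<mu> g Q \<noteq> 0 \<longleftrightarrow> g i \<noteq> 0" using \<mu> by auto
  qed
qed

lemma card_le_mult: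
  assumes \<mu>: "\<mu> * \<mu> = 1" and J: "J \<subseteq> {0..int k}"
    and g: "\<And>j b. g j (- b) = - \<mu> * g j b" "\<And>j b. g j (b + 2 * int k) = g j b"
    and diag: "\<And>i j. i \<in> J \<Longrightarrow> j \<in> J \<Longrightarrow> g j i \<noteq> 0 \<longleftrightarrow> i = j"
  shows "card J \<le> lap_mult V adj (3 - \<mu>)"
proof -
  have "\<forall>i\<in>J. \<exists>Q. \<forall>j. wave_on_V \<mu> (g j) Q \<noteq> 0 \<longleftrightarrow> g j i \<noteq> 0"
  proof
    fix i assume "i \<in> J"
    hence "0 \<le> i" "i \<le> int k" using J by auto
    from wave_on_V_point[OF this] \<mu> g show "\<exists>Q. \<forall>j. wave_on_V \<mu> (g j) Q \<noteq> 0 \<longleftrightarrow> g j i \<noteq> 0"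
      by metis
  qed
  then obtain P where P: "\<And>i j. i \<in> J \<Longrightarrow> wave_on_V \<mu> (g j) (P i) \<noteq> 0 \<longleftrightarrow> g j i \<noteq> 0"
    unfolding bchoice_iff by blast
  show ?thesis
  proof (rule card_le_lap_mult[where F = "\<lambda>j. wave_on_V \<mu> (g j)" and P = P])
    show "finite J" using J finite_subset by blast
    show "wave_on_V \<mu> (g j) \<in> lap_eigenspace V adj (3 - \<mu>)" for j
      by (rule wave_on_V_eigen[OF \<mu> g])
    show "wave_on_V \<mu> (g j) (P i) \<noteq> 0 \<longleftrightarrow> i = j" if "i \<in> J" "j \<in> J" for i j
      using P[OF that(1)] diag[OF that] by blast
  qed (rule finite_V)
qed

section \<open>Even and odd periodic test functions\<close>

definition comb :: "int \<Rightarrow> int \<Rightarrow> complex" where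
  "comb j b = (if 2 * int k dvd b - j then 1 else 0)"

lemma comb_periodic: "comb j (b + 2 * int k) = comb j b"
proof -
  have "b + 2 * int k - j = (b - j) + 2 * int k" by simp
  thus ?thesis unfolding comb_def by (simp only: dvd_add_triv_right_iff)
qed

lemma comb_minus: "comb j (- b) = comb (- j) b"
proof -
  have "- b - j = - (b - (- j))" by simp
  thus ?thesis unfolding comb_def by (simp only: dvd_minus_iff)
qed

lemma comb_eq:
  assumes "0 \<le> i" "i \<le> int k" "0 \<le> j" "j \<le> int k"
  shows "comb j i = (if i = j then 1 else 0)" "i \<noteq> j \<Longrightarrow> comb (- j) i = 0"
    "0 < i \<Longrightarrow> i < int k \<Longrightarrow> comb (- j) i = 0"
proof -
  have le: "x = 0 \<or> 2 * int k \<le> \<bar>x\<bar>" if "2 * int k dvd x" for x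
    using dvd_imp_le_int[OF _ that] by fastforce
  show "comb j i = (if i = j then 1 else 0)"
    using le[of "i - j"] assms k_pos by (auto simp: comb_def)
  show "comb (- j) i = 0" if "i \<noteq> j"
    using le[of "i + j"] assms that by (auto simp: comb_def)
  show "comb (- j) i = 0" if "0 < i" "i < int k"
    using le[of "i + j"] assms that by (auto simp: comb_def)
qed

theorem mult_4: "k + 1 \<le> lap_mult V adj 4"
proof -
  have "card {0..int k} \<le> lap_mult V adj (3 - (- 1))"
  proof (rule card_le_mult[where g = "\<lambda>j b. comb j b + comb (- j) b"])
    fix i j assume "i \<in> {0..int k}" "j \<in> {0..int k}"
    hence ij: "0 \<le> i" "i \<le> int k" "0 \<le> j" "j \<le> int k" by auto
    \<comment> \<open>For i = j = 0 and i = j = k both combs contribute and the diagonal value is 2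
      instead of 1.\<close>
    have "1 + comb (- j) i \<noteq> 0" by (simp add: comb_def)
    thus "comb j i + comb (- j) i \<noteq> 0 \<longleftrightarrow> i = j" using comb_eq(1,2)[OF ij] by auto
  qed (simp_all add: comb_periodic comb_minus)
  thus ?thesis by simp
qed

text \<open>An odd function of period 2 k vanishes at 0 and at k, so these two indices drop
  out.\<close>

theorem mult_2: "k - 1 \<le> lap_mult V adj 2"
proof -
  have "card {1..int k - 1} \<le> lap_mult V adj (3 - 1)"
  proof (rule card_le_mult[where g = "\<lambda>j b. comb j b - comb (- j) b"])
    fix i j assume "i \<in> {1..int k - 1}" "j \<in> {1..int k - 1}"
    hence ij: "0 \<le> i" "i \<le> int k" "0 \<le> j" "j \<le> int k" "0 < i" "i < int k" by auto
    show "comb j i - comb (- j) i \<noteq> 0 \<longleftrightarrow> i = j"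
      using comb_eq(1)[OF ij(1-4)] comb_eq(3)[OF ij] by auto
  qed (auto simp: comb_periodic comb_minus)
  thus ?thesis by simp
qed

end

section \<open>The covering of the tetrahedron graph and the final bounds\<close>

lemma plane_map_to_K4:
  fixes D :: "'d set" and \<alpha> \<sigma> :: "'d \<Rightarrow> 'd"
  assumes X: "plane_cubic_simple_map D \<alpha> \<sigma>"
    and faces3: "\<forall>d\<in>D. 3 dvd card (orb (\<sigma> \<circ> \<alpha>) d)"
  obtains \<pi> d0 where "d0 \<in> D" "\<pi> d0 = (0, 0, 0)" "\<And>d. d \<in> D \<Longrightarrow> \<pi> d \<in> K4"
    "\<And>d. d \<in> D \<Longrightarrow> \<pi> (\<sigma> d) = rot4 (\<pi> d)" "\<And>d. d \<in> D \<Longrightarrow> \<pi> (\<alpha> d) = flip4 (\<pi> d)"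
proof -
  note X' = X[unfolded plane_cubic_simple_map_def]
  have "D \<noteq> {}" using X' by blast
  then obtain d0 where d0: "d0 \<in> D" by blast
  have fin: "finite D" and bij: "bij_betw \<sigma> D D" using X' by blast+
  have inv: "\<alpha> d \<in> D \<and> \<alpha> d \<noteq> d \<and> \<alpha> (\<alpha> d) = d" if "d \<in> D" for d
    using X' that by (meson bij_betwE)
  have \<sigma>3: "\<sigma> d \<noteq> d" "(\<sigma> ^^ 3) d = d" if "d \<in> D" for d
    using X' that by (auto simp: numeral_3_eq_3)
  have orb3: "card (orb \<sigma> d) = 3" if d: "d \<in> D" for d
  proof -
    have "card (orb \<sigma> d) dvd 3" by (rule card_orb_eq_period(2)[OF fin bij d \<sigma>3(2)[OF d]])
    moreover have "card (orb \<sigma> d) \<noteq> 1"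
    proof
      assume "card (orb \<sigma> d) = 1"
      then obtain x where "orb \<sigma> d = {x}" by (rule card_1_singletonE)
      moreover have "(\<sigma> ^^ 0) d \<in> orb \<sigma> d" "(\<sigma> ^^ 1) d \<in> orb \<sigma> d" unfolding orb_def by blast+
      ultimately show False using \<sigma>3(1)[OF d] by simp
    qed
    moreover have "prime (3::nat)" by simp
    ultimately show ?thesis by (auto simp: prime_nat_iff)
  qed
  have conn: "(d, d') \<in> (graph_rel D \<sigma> \<union> graph_rel D \<alpha>)\<^sup>*" if "d \<in> D" "d' \<in> D" for d d'
    using X' that unfolding graph_rel_def by blast
  have euler: "int (card (orb \<sigma> ` D)) - int (card (orb \<alpha> ` D)) + int (card (orb (\<sigma> \<circ> \<alpha>) ` D)) = 2"
    using X' by blast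
  have flip: "flip4 \<kappa> \<in> K4 \<and> flip4 (flip4 \<kappa>) = \<kappa>" if "\<kappa> \<in> K4" for \<kappa>
    using flip4_in flip4_flip4 that by blast
  have per: "(rot4 ^^ card (orb \<sigma> d)) \<kappa> = \<kappa>" if "d \<in> D" "\<kappa> \<in> K4" for d \<kappa>
    using orb3[OF that(1)] rot4_cubed[OF that(2)] by (simp add: numeral_3_eq_3)
  have per_face: "((rot4 \<circ> flip4) ^^ card (orb (\<sigma> \<circ> \<alpha>) d)) \<kappa> = \<kappa>" if d: "d \<in> D" and \<kappa>: "\<kappa> \<in> K4" for d \<kappa>
  proof -
    obtain c where c: "card (orb (\<sigma> \<circ> \<alpha>) d) = 3 * c" using faces3 d by (auto simp: dvd_def)
    have "(((rot4 \<circ> flip4) ^^ 3) ^^ c) \<kappa> = \<kappa>"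
      by (induction c) (use rot4_flip4_cubed[OF \<kappa>] in \<open>simp_all add: numeral_3_eq_3\<close>)
    thus ?thesis by (simp add: c funpow_mult mult.commute)
  qed
  obtain \<pi> where "\<pi> d0 = (0, 0, 0)" "\<And>d. d \<in> D \<Longrightarrow> \<pi> d \<in> K4"
    "\<And>d. d \<in> D \<Longrightarrow> \<pi> (\<sigma> d) = rot4 (\<pi> d)" "\<And>d. d \<in> D \<Longrightarrow> \<pi> (\<alpha> d) = flip4 (\<pi> d)"
    using plane_map_section[OF fin bij inv conn euler finite_K4 bij_rot4 flip per per_face d0 zero_in_K4]
    by blast
  with d0 show ?thesis by (rule that)
qed

theorem theorem1p6:
  fixes D :: "'d set" and \<alpha> \<sigma> :: "'d \<Rightarrow> 'd"
  assumes X: "plane_cubic_simple_map D \<alpha> \<sigma>"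
    and faces3: "\<forall>d\<in>D. 3 dvd card (orb (\<sigma> \<circ> \<alpha>) d)"
  shows "lap_mult (gc_verts D \<alpha> \<sigma> 2 0) (gc_adj D \<alpha> \<sigma> 2 0) 4 \<ge> 3 \<and>
         (\<forall>k::nat. k \<ge> 1 \<longrightarrow>
           lap_mult (gc_verts D \<alpha> \<sigma> k 0) (gc_adj D \<alpha> \<sigma> k 0) 4 \<ge> nat \<lceil>real k / 2\<rceil> \<and>
           lap_mult (gc_verts D \<alpha> \<sigma> k 0) (gc_adj D \<alpha> \<sigma> k 0) 2 \<ge> nat \<lfloor>real k / 2\<rfloor> \<and>
           lap_mult (gc_verts D \<alpha> \<sigma> k k) (gc_adj D \<alpha> \<sigma> k k) 4 \<ge> nat \<lceil>real k / 2\<rceil> \<and>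
           lap_mult (gc_verts D \<alpha> \<sigma> k k) (gc_adj D \<alpha> \<sigma> k k) 2 \<ge> nat \<lfloor>real k / 2\<rfloor>)"
proof -
  obtain \<pi> d0 where \<pi>: "d0 \<in> D" "\<pi> d0 = (0, 0, 0)" "\<And>d. d \<in> D \<Longrightarrow> \<pi> d \<in> K4"
    "\<And>d. d \<in> D \<Longrightarrow> \<pi> (\<sigma> d) = rot4 (\<pi> d)" "\<And>d. d \<in> D \<Longrightarrow> \<pi> (\<alpha> d) = flip4 (\<pi> d)"
    using plane_map_to_K4[OF X faces3] by metis
  note X' = X[unfolded plane_cubic_simple_map_def]
  have loc: "planar_gc k l D \<alpha> \<sigma> \<pi> d0" if "k \<ge> 1" "l = 0 \<or> l = k" for k l
  proof unfold_locales
    show "k > 0" "l = 0 \<or> l = k" using that by auto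
    show "finite D" using X' by blast
    show "\<sigma> d \<in> D" "\<sigma> (\<sigma> (\<sigma> d)) = d" "\<alpha> d \<in> D" "\<alpha> (\<alpha> d) = d" if "d \<in> D" for d
      using X' that by (meson bij_betwE)+
  qed (use \<pi> in auto)
  have bounds: "lap_mult (gc_verts D \<alpha> \<sigma> k l) (gc_adj D \<alpha> \<sigma> k l) 4 \<ge> k + 1"
    "lap_mult (gc_verts D \<alpha> \<sigma> k l) (gc_adj D \<alpha> \<sigma> k l) 2 \<ge> k - 1" if "k \<ge> 1" "l = 0 \<or> l = k" for k l
    using planar_gc.mult_4[OF loc[OF that]] planar_gc.mult_2[OF loc[OF that]] by auto
  have half: "nat \<lceil>real k / 2\<rceil> \<le> k + 1" "nat \<lfloor>real k / 2\<rfloor> \<le> k - 1" if "k \<ge> 1" for k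
    using that by linarith+
  show ?thesis
  proof (intro conjI allI impI)
    show "lap_mult (gc_verts D \<alpha> \<sigma> 2 0) (gc_adj D \<alpha> \<sigma> 2 0) 4 \<ge> 3" using bounds(1)[of 2 0] by simp
  qed (rule order_trans[OF half(1) bounds(1)] order_trans[OF half(2) bounds(2)]; simp)+
qed

end
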